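(* Let $\mathcal{M}$ be a finite MDP in which distinct states have pairwise disjoint sets of enabled actions, and let $\mathcal{N}$ be its MEC-quotient. Then for each MR-scheduler $\mathfrak{S}$ for $\mathcal{N}$ with $\mathfrak{S}(s_{\mathcal{E}})(\tau)\in\{0,1\}$ for each maximal end component $\mathcal{E}$ of $\mathcal{M}$, there is an MR-scheduler $\mathfrak{T}$ for $\mathcal{M}$ such that every action $\alpha$ of $\mathcal{M}$ that does not belong to a maximal end component of $\mathcal{M}$ has the same expected frequency under $\mathfrak{S}$ in $\mathcal{N}$ and under $\mathfrak{T}$ in $\mathcal{M}$.
   Context: An MDP is $\mathcal{M}=(S,\mathit{Act},P,\mathsf{init})$ with finite $S$, finite $\mathit{Act}$, $P:S\times\mathit{Act}\times S\to[0,1]$ with $\sum_tP(s,\alpha,t)\in\{0,1\}$; $\mathit{Act}(s)$ is the set of $\alpha$ with sum $1$, and $s$ is terminal if $\mathit{Act}(s)=\emptyset$. A scheduler maps finite non-maximal paths to distributions over enabled actions of the last state; MR (memoryless randomized) if the choice depends only on the last state. An end component is a nonempty set $\mathcal{E}$ of state-action pairs $(s,\alpha)$ with $\alpha\in\mathit{Act}(s)$ such that for each $(s,\alpha)\in\mathcal{E}$ all $t$ with $P(s,\alpha,t)>0$ are states of $\mathcal{E}$, and the graph on the states of $\mathcal{E}$ induced by $\mathcal{E}$ is strongly connected; it is maximal (MEC) if not properly contained in another end component. Since actions of distinct states are disjoint, an MEC may be viewed as a set of actions. MEC-quotient: let $\mathcal{E}_1,\dots,\mathcal{E}_k$ be the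 MECs of $\mathcal{M}$ with state sets $U_1,\dots,U_k$, $U=\bigcup_iU_i$. The MEC-quotient $\mathcal{N}$ has states $(S\setminus U)\cup\{s_{\mathcal{E}_1},\dots,s_{\mathcal{E}_k},\bot\}$ (fresh states), with $\iota(s)=s$ for $s\notin U$ and $\iota(u)=s_{\mathcal{E}_i}$ for $u\in U_i$; initial state $\iota(\mathsf{init})$; actions $\mathit{Act}\cup\{\tau\}$ with fresh $\tau$. A state $s\in S\setminus U$ has the same enabled actions as in $\mathcal{M}$ with $P_{\mathcal{N}}(s,\alpha,s')=P(s,\alpha,\iota^{-1}(s'))$. State $s_{\mathcal{E}_i}$ has enabled actions $\bigcup_{u\in U_i}(\mathit{Act}(u)\setminus\mathcal{E}_i)\cup\{\tau\}$, with $P_{\mathcal{N}}(s_{\mathcal{E}_i},\tau,\bot)=1$ and $P_{\mathcal{N}}(s_{\mathcal{E}_i},\alpha,s')=P(u,\alpha,\iota^{-1}(s'))$ for $u\in U_i$, $\alpha\in\mathit{Act}(u)\setminus\mathcal{E}_i$; $\bot$ is terminal. The expected frequency of an action $\alpha$ under a scheduler is the expected number of times $\alpha$ is taken along a maximal path starting in the initial state. *)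

theory Defs
  imports "HOL-Probability.Probability"
begin

record ('s, 'a) mdp =
  states :: "'s set"
  acts :: "'a set"
  trans :: "'s \<Rightarrow> 'a \<Rightarrow> 's \<Rightarrow> real"
  initial :: 's

definition is_mdp :: "('s, 'a) mdp \<Rightarrow> bool" where
  "is_mdp M \<longleftrightarrow> finite (states M) \<and> finite (acts M) \<and> initial M \<in> states M \<and>
     (\<forall>s\<in>states M. \<forall>\<alpha>\<in>acts M.
        (\<forall>t\<in>states M. 0 \<le> trans M s \<alpha> t \<and> trans M s \<alpha> t \<le> 1) \<and>
        (\<Sum>t\<in>states M. trans M s \<alpha> t) \<in> {0, 1})"

definition enabled :: "('s, 'a) mdp \<Rightarrow> 's \<Rightarrow> 'a set" where
  "enabled M s = {\<alpha> \<in> acts M. (\<Sum>t\<in>states M. trans M s \<alpha> t) = 1}"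

definition terminal :: "('s, 'a) mdp \<Rightarrow> 's \<Rightarrow> bool" where
  "terminal M s \<longleftrightarrow> enabled M s = {}"

(* A memoryless scheduler is identified with its choice as a function of the last state of the
   path; its value at terminal states is irrelevant. *)
definition mr_scheduler :: "('s, 'a) mdp \<Rightarrow> ('s \<Rightarrow> 'a pmf) \<Rightarrow> bool" where
  "mr_scheduler M \<sigma> \<longleftrightarrow>
     (\<forall>s\<in>states M. \<not> terminal M s \<longrightarrow> set_pmf (\<sigma> s) \<subseteq> enabled M s)"

(* A maximal path is encoded as a sequence of pairs (state, action taken there). A finite maximal
   path, ending in a terminal state s, is padded with infinitely many copies of (s, None). *)
definition steps :: "('s, 'a) mdp \<Rightarrow> ('s \<times> 'a option) set" where
  "steps M = {(s, Some \<alpha>) | s \<alpha>. s \<in> states M \<and> \<alpha> \<in> enabled M s} \<union>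
             {(s, None) | s. s \<in> states M \<and> terminal M s}"

definition choice_prob :: "('s, 'a) mdp \<Rightarrow> ('s \<Rightarrow> 'a pmf) \<Rightarrow> 's \<Rightarrow> 'a option \<Rightarrow> real" where
  "choice_prob M \<sigma> s b =
     (case b of None \<Rightarrow> if terminal M s then 1 else 0
              | Some \<alpha> \<Rightarrow> if terminal M s then 0 else pmf (\<sigma> s) \<alpha>)"

definition step_prob ::
  "('s, 'a) mdp \<Rightarrow> ('s \<Rightarrow> 'a pmf) \<Rightarrow> 's \<times> 'a option \<Rightarrow> 's \<times> 'a option \<Rightarrow> real" where
  "step_prob M \<sigma> x y =
     (case x of (s, None) \<Rightarrow> if y = x then 1 else 0
              | (s, Some \<alpha>) \<Rightarrow> trans M s \<alpha> (fst y) * choice_prob M \<sigma> (fst y) (snd y))"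

primrec step_kernel :: "('s, 'a) mdp \<Rightarrow> ('s \<Rightarrow> 'a pmf) \<Rightarrow> nat \<Rightarrow>
    (nat \<Rightarrow> 's \<times> 'a option) \<Rightarrow> ('s \<times> 'a option) measure" where
  "step_kernel M \<sigma> 0 \<omega> = point_measure (steps M)
     (\<lambda>y. ennreal (if fst y = initial M then choice_prob M \<sigma> (fst y) (snd y) else 0))"
| "step_kernel M \<sigma> (Suc n) \<omega> = point_measure (steps M) (\<lambda>y. ennreal (step_prob M \<sigma> (\<omega> n) y))"

(* The Ionescu-Tulcea measure of the kernels above. *)
definition path_measure ::
  "('s, 'a) mdp \<Rightarrow> ('s \<Rightarrow> 'a pmf) \<Rightarrow> (nat \<Rightarrow> 's \<times> 'a option) measure" where
  "path_measure M \<sigma> =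
     projective_family.lim UNIV
       (Ionescu_Tulcea.CI (step_kernel M \<sigma>) (\<lambda>_. count_space (steps M)))
       (\<lambda>_. count_space (steps M))"

definition expected_frequency :: "('s, 'a) mdp \<Rightarrow> ('s \<Rightarrow> 'a pmf) \<Rightarrow> 'a \<Rightarrow> ennreal" where
  "expected_frequency M \<sigma> \<alpha> =
     (\<integral>\<^sup>+ \<omega>. (\<Sum>n. if snd (\<omega> n) = Some \<alpha> then 1 else 0) \<partial>path_measure M \<sigma>)"

definition end_component :: "('s, 'a) mdp \<Rightarrow> ('s \<times> 'a) set \<Rightarrow> bool" where
  "end_component M E \<longleftrightarrow> E \<noteq> {} \<and>
     (\<forall>(s, \<alpha>)\<in>E. s \<in> states M \<and> \<alpha> \<in> enabled M s \<and>
        (\<forall>t\<in>states M. trans M s \<alpha> t > 0 \<longrightarrow> t \<in> fst ` E)) \<and>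
     (\<forall>s\<in>fst ` E. \<forall>t\<in>fst ` E.
        (s, t) \<in> {(u, v). v \<in> states M \<and> (\<exists>\<alpha>. (u, \<alpha>) \<in> E \<and> trans M u \<alpha> v > 0)}\<^sup>*)"

definition mec :: "('s, 'a) mdp \<Rightarrow> ('s \<times> 'a) set \<Rightarrow> bool" where
  "mec M E \<longleftrightarrow> end_component M E \<and> \<not> (\<exists>E'. end_component M E' \<and> E \<subset> E')"

definition mec_states :: "('s, 'a) mdp \<Rightarrow> 's set" where
  "mec_states M = (\<Union>E\<in>{E. mec M E}. fst ` E)"

datatype ('s, 'a) qstate = Orig 's | Mec "('s \<times> 'a) set" | Bot

datatype 'a qact = Act 'a | Tau

definition quot_map :: "('s, 'a) mdp \<Rightarrow> 's \<Rightarrow> ('s, 'a) qstate" where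
  "quot_map M s =
     (if s \<in> mec_states M then Mec (THE E. mec M E \<and> s \<in> fst ` E) else Orig s)"

definition trans_quot :: "('s, 'a) mdp \<Rightarrow> 's \<Rightarrow> 'a \<Rightarrow> ('s, 'a) qstate \<Rightarrow> real" where
  "trans_quot M s \<alpha> q = (\<Sum>t\<in>{t \<in> states M. quot_map M t = q}. trans M s \<alpha> t)"

definition exits :: "('s, 'a) mdp \<Rightarrow> ('s \<times> 'a) set \<Rightarrow> ('s \<times> 'a) set" where
  "exits M E = {(u, \<alpha>). u \<in> fst ` E \<and> \<alpha> \<in> enabled M u \<and> (u, \<alpha>) \<notin> E}"

(* When distinct states have disjoint sets of enabled actions, the state u of an exit is
   determined by its action. *)
definition mec_quotient :: "('s, 'a) mdp \<Rightarrow> (('s, 'a) qstate, 'a qact) mdp" where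
  "mec_quotient M = \<lparr>
     states = Orig ` (states M - mec_states M) \<union> Mec ` {E. mec M E} \<union> {Bot},
     acts = Act ` acts M \<union> {Tau},
     trans = (\<lambda>q a q'. case q of
         Orig s \<Rightarrow> (case a of Act \<alpha> \<Rightarrow> trans_quot M s \<alpha> q' | Tau \<Rightarrow> 0)
       | Mec E \<Rightarrow> (case a of
             Act \<alpha> \<Rightarrow> if \<alpha> \<in> snd ` exits M E
                      then trans_quot M (THE u. (u, \<alpha>) \<in> exits M E) \<alpha> q' else 0
           | Tau \<Rightarrow> if q' = Bot then 1 else 0)
       | Bot \<Rightarrow> 0),
     initial = quot_map M (initial M)\<rparr>"


subsection \<open>Well-definedness\<close>

lemma finite_steps: "is_mdp M \<Longrightarrow> finite (steps M)"
  by (rule finite_subset[of _ "states M \<times> ({None} \<union> Some ` acts M)"])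
     (auto simp: is_mdp_def steps_def enabled_def)

lemma sum_steps:
  assumes M: "is_mdp M" and \<sigma>: "mr_scheduler M \<sigma>"
  shows "(\<Sum>y\<in>steps M. f (fst y) * choice_prob M \<sigma> (fst y) (snd y)) = (\<Sum>t\<in>states M. f t)"
proof -
  let ?B = "\<lambda>t. if terminal M t then {None} else Some ` enabled M t"
  have fin: "finite (states M)" "finite (?B t)" for t
    using M by (auto simp: is_mdp_def enabled_def)
  have eq: "steps M = Sigma (states M) ?B"
    by (auto simp: steps_def terminal_def split: if_splits)
  have inner: "(\<Sum>b\<in>?B t. choice_prob M \<sigma> t b) = 1" if t: "t \<in> states M" for t
  proof (cases "terminal M t")
    case True
    then show ?thesis by (simp add: choice_prob_def)
  next
    case False
    then have "set_pmf (\<sigma> t) \<subseteq> enabled M t" "finite (enabled M t)"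
      using \<sigma> t M by (auto simp: mr_scheduler_def is_mdp_def enabled_def)
    then have "(\<Sum>\<alpha>\<in>enabled M t. pmf (\<sigma> t) \<alpha>) = 1"
      by (rule sum_pmf_eq_1[rotated])
    then show ?thesis
      using False by (simp add: choice_prob_def sum.reindex)
  qed
  have "(\<Sum>y\<in>steps M. f (fst y) * choice_prob M \<sigma> (fst y) (snd y)) =
        (\<Sum>t\<in>states M. \<Sum>b\<in>?B t. f t * choice_prob M \<sigma> t b)"
    unfolding eq by (subst sum.Sigma) (auto simp: fin case_prod_beta)
  also have "\<dots> = (\<Sum>t\<in>states M. f t)"
    by (intro sum.cong refl) (simp only: inner mult_1_right flip: sum_distrib_left)
  finally show ?thesis .
qed

lemma choice_prob_nonneg: "0 \<le> choice_prob M \<sigma> s b"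
  by (auto simp: choice_prob_def split: option.split)

lemma step_prob_nonneg:
  "is_mdp M \<Longrightarrow> x \<in> steps M \<Longrightarrow> y \<in> steps M \<Longrightarrow> 0 \<le> step_prob M \<sigma> x y"
  by (auto simp: step_prob_def steps_def is_mdp_def enabled_def choice_prob_nonneg)

lemma sum_step_prob:
  assumes M: "is_mdp M" and \<sigma>: "mr_scheduler M \<sigma>" and x: "x \<in> steps M"
  shows "(\<Sum>y\<in>steps M. step_prob M \<sigma> x y) = 1"
proof (cases "snd x")
  case None
  then have "(\<Sum>y\<in>steps M. step_prob M \<sigma> x y) = (\<Sum>y\<in>steps M. if y = x then 1 else 0)"
    by (intro sum.cong refl) (auto simp: step_prob_def split: prod.splits)
  then show ?thesis
    using x finite_steps[OF M] by simp
next
  case (Some \<alpha>)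
  then have "(\<Sum>y\<in>steps M. step_prob M \<sigma> x y) =
      (\<Sum>y\<in>steps M. trans M (fst x) \<alpha> (fst y) * choice_prob M \<sigma> (fst y) (snd y))"
    by (intro sum.cong refl) (auto simp: step_prob_def split: prod.splits)
  also have "\<dots> = 1"
    using x Some by (subst sum_steps[OF M \<sigma>]) (auto simp: steps_def enabled_def)
  finally show ?thesis .
qed

lemma Ionescu_Tulcea_step_kernel:
  assumes M: "is_mdp M" and \<sigma>: "mr_scheduler M \<sigma>"
  shows "Ionescu_Tulcea (step_kernel M \<sigma>) (\<lambda>_. count_space (steps M))"
proof -
  note fin = finite_steps[OF M]
  have PiM: "PiM {0..<i} (\<lambda>_. count_space (steps M)) = count_space ({0..<i} \<rightarrow>\<^sub>E steps M)" for i :: nat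
    by (rule count_space_PiM_finite) (auto simp: fin countable_finite)
  have prob: "prob_space (step_kernel M \<sigma> i x)" if x: "x \<in> {0..<i} \<rightarrow>\<^sub>E steps M" for i x
  proof (cases i)
    case 0
    let ?f = "\<lambda>t. if t = initial M then 1 else 0 :: real"
    have "(\<Sum>y\<in>steps M. ?f (fst y) * choice_prob M \<sigma> (fst y) (snd y)) = 1"
      using M by (subst sum_steps[OF M \<sigma>]) (auto simp: is_mdp_def)
    then have "(\<Sum>y\<in>steps M. ennreal (?f (fst y) * choice_prob M \<sigma> (fst y) (snd y))) = 1"
      by (subst sum_ennreal) (auto simp: choice_prob_nonneg)
    moreover have "(if fst y = initial M then choice_prob M \<sigma> (fst y) (snd y) else 0)
        = ?f (fst y) * choice_prob M \<sigma> (fst y) (snd y)" for y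
      by simp
    ultimately show ?thesis
      unfolding 0 step_kernel.simps by (intro prob_space_point_measure fin) simp_all
  next
    case (Suc n)
    then have "x n \<in> steps M"
      using x by auto
    then have "(\<Sum>y\<in>steps M. ennreal (step_prob M \<sigma> (x n) y)) = 1"
      by (subst sum_ennreal) (auto simp: step_prob_nonneg[OF M] sum_step_prob[OF M \<sigma>])
    then show ?thesis
      unfolding Suc step_kernel.simps by (intro prob_space_point_measure fin) simp_all
  qed
  have sets: "sets (step_kernel M \<sigma> i x) = sets (count_space (steps M))" for i x
    by (cases i) (simp_all add: sets_point_measure)
  show ?thesis
  proof (rule Ionescu_Tulcea.intro)
    show "step_kernel M \<sigma> i \<in> measurable (PiM {0..<i} (\<lambda>_. count_space (steps M)))
            (subprob_algebra (count_space (steps M)))" for i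
      unfolding PiM
      by (auto simp: space_subprob_algebra sets intro!: prob_space_imp_subprob_space prob)
    show "prob_space (step_kernel M \<sigma> i x)"
      if "x \<in> space (PiM {0..<i} (\<lambda>_. count_space (steps M)))" for i x
      using that unfolding PiM by (intro prob) simp
  qed
qed

lemma mec_unique:
  assumes E: "mec M E" and F: "mec M F" and s: "s \<in> fst ` E" "s \<in> fst ` F"
  shows "E = F"
proof -
  let ?R = "\<lambda>E. {(u, v). v \<in> states M \<and> (\<exists>\<alpha>. (u, \<alpha>) \<in> E \<and> trans M u \<alpha> v > 0)}"
  have EC: "end_component M E" "end_component M F"
    using E F by (auto simp: mec_def)
  have mono: "(?R E)\<^sup>* \<subseteq> (?R (E \<union> F))\<^sup>*" "(?R F)\<^sup>* \<subseteq> (?R (E \<union> F))\<^sup>*"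
    by (rule rtrancl_mono; blast)+
  have conn: "(u, s) \<in> (?R (E \<union> F))\<^sup>* \<and> (s, u) \<in> (?R (E \<union> F))\<^sup>*" if u: "u \<in> fst ` (E \<union> F)" for u
  proof -
    have "\<forall>u\<in>fst ` E. \<forall>v\<in>fst ` E. (u, v) \<in> (?R E)\<^sup>*" "\<forall>u\<in>fst ` F. \<forall>v\<in>fst ` F. (u, v) \<in> (?R F)\<^sup>*"
      using EC unfolding end_component_def by blast+
    with u s mono show ?thesis
      unfolding image_Un by blast
  qed
  have "end_component M (E \<union> F)"
    unfolding end_component_def
  proof (intro conjI)
    show "E \<union> F \<noteq> {}" using EC by (auto simp: end_component_def)
    show "\<forall>(u, \<alpha>)\<in>E \<union> F. u \<in> states M \<and> \<alpha> \<in> enabled M u \<and>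
        (\<forall>t\<in>states M. trans M u \<alpha> t > 0 \<longrightarrow> t \<in> fst ` (E \<union> F))"
      using EC unfolding end_component_def image_Un by blast
    show "\<forall>u\<in>fst ` (E \<union> F). \<forall>v\<in>fst ` (E \<union> F). (u, v) \<in> (?R (E \<union> F))\<^sup>*"
      using conn by (meson rtrancl_trans)
  qed
  with E F show ?thesis
    unfolding mec_def by (metis Un_upper1 Un_upper2 psubsetI)
qed

lemma quot_map_Mec: "mec M E \<Longrightarrow> s \<in> fst ` E \<Longrightarrow> quot_map M s = Mec E"
  unfolding quot_map_def mec_states_def
  by (auto intro!: the_equality dest: mec_unique)

lemma quot_map_in_states:
  assumes "s \<in> states M"
  shows "quot_map M s \<in> states (mec_quotient M)"
proof (cases "s \<in> mec_states M")
  case True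
  then obtain E where "mec M E" "s \<in> fst ` E"
    by (auto simp: mec_states_def)
  then show ?thesis
    by (simp add: quot_map_Mec mec_quotient_def)
next
  case False
  then show ?thesis
    using assms by (simp add: quot_map_def mec_quotient_def)
qed

lemma finite_states_mec_quotient:
  assumes "is_mdp M"
  shows "finite (states (mec_quotient M))"
proof -
  have "{E. mec M E} \<subseteq> Pow (states M \<times> acts M)"
    by (auto simp: mec_def end_component_def enabled_def)
  then show ?thesis
    using assms by (auto simp: mec_quotient_def is_mdp_def intro: finite_subset)
qed

lemma sum_trans_quot:
  assumes "is_mdp M"
  shows "(\<Sum>q\<in>states (mec_quotient M). trans_quot M s \<alpha> q) = (\<Sum>t\<in>states M. trans M s \<alpha> t)"
  unfolding trans_quot_def
  by (rule sum.group) (use assms finite_states_mec_quotient quot_map_in_states in \<open>auto simp: is_mdp_def\<close>)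

lemma exits_in_states: "mec M E \<Longrightarrow> (u, \<alpha>) \<in> exits M E \<Longrightarrow> u \<in> states M \<and> \<alpha> \<in> enabled M u"
  by (auto simp: exits_def mec_def end_component_def)

lemma the_exit:
  assumes "\<And>s t. s \<in> states M \<Longrightarrow> t \<in> states M \<Longrightarrow> s \<noteq> t \<Longrightarrow> enabled M s \<inter> enabled M t = {}"
    and "mec M E" "(u, \<alpha>) \<in> exits M E"
  shows "(THE u. (u, \<alpha>) \<in> exits M E) = u"
  using assms exits_in_states[OF assms(2)] by (intro the_equality) blast+

lemma trans_quot_bounds:
  assumes M: "is_mdp M" and s: "s \<in> states M" "\<alpha> \<in> acts M"
  shows "0 \<le> trans_quot M s \<alpha> q" "trans_quot M s \<alpha> q \<le> 1"
proof -
  have nonneg: "0 \<le> trans M s \<alpha> t" if "t \<in> states M" for t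
    using M s that by (auto simp: is_mdp_def)
  then show "0 \<le> trans_quot M s \<alpha> q"
    unfolding trans_quot_def by (intro sum_nonneg) auto
  have "trans_quot M s \<alpha> q \<le> (\<Sum>t\<in>states M. trans M s \<alpha> t)"
    unfolding trans_quot_def
    by (rule sum_mono2) (use M nonneg in \<open>auto simp: is_mdp_def\<close>)
  also have "\<dots> \<le> 1"
    using M s by (force simp: is_mdp_def)
  finally show "trans_quot M s \<alpha> q \<le> 1" .
qed

lemma is_mdp_mec_quotient:
  assumes M: "is_mdp M"
    and disj: "\<And>s t. s \<in> states M \<Longrightarrow> t \<in> states M \<Longrightarrow> s \<noteq> t \<Longrightarrow> enabled M s \<inter> enabled M t = {}"
  shows "is_mdp (mec_quotient M)"
proof -
  let ?N = "mec_quotient M"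
  have ok: "(\<forall>q'\<in>states ?N. 0 \<le> trans_quot M s \<alpha> q' \<and> trans_quot M s \<alpha> q' \<le> 1) \<and>
      (\<Sum>q'\<in>states ?N. trans_quot M s \<alpha> q') \<in> {0, 1}" if "s \<in> states M" "\<alpha> \<in> acts M" for s \<alpha>
    using M that trans_quot_bounds[OF M that] by (auto simp: sum_trans_quot[OF M] is_mdp_def)
  have row: "(\<forall>q'\<in>states ?N. 0 \<le> trans ?N q a q' \<and> trans ?N q a q' \<le> 1) \<and>
      (\<Sum>q'\<in>states ?N. trans ?N q a q') \<in> {0, 1}" if q: "q \<in> states ?N" and a: "a \<in> acts ?N" for q a
  proof (cases q)
    case (Orig s)
    have s: "s \<in> states M" using q Orig by (auto simp: mec_quotient_def)
    show ?thesis
    proof (cases a)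
      case (Act \<alpha>)
      then have "\<alpha> \<in> acts M" using a by (auto simp: mec_quotient_def)
      from ok[OF s this] show ?thesis
        unfolding Orig Act by (simp add: mec_quotient_def)
    qed (simp add: Orig mec_quotient_def)
  next
    case (Mec E)
    have E: "mec M E" using q Mec by (auto simp: mec_quotient_def)
    show ?thesis
    proof (cases a)
      case (Act \<alpha>)
      show ?thesis
      proof (cases "\<alpha> \<in> snd ` exits M E")
        case True
        then obtain u where u: "(u, \<alpha>) \<in> exits M E" by auto
        then have "u \<in> states M" "\<alpha> \<in> acts M"
          using exits_in_states[OF E u] by (auto simp: enabled_def)
        from ok[OF this] True show ?thesis
          unfolding Mec Act by (simp add: mec_quotient_def the_exit[OF disj E u])
      qed (simp add: Mec Act mec_quotient_def)
    next
      case Tau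
      have "(\<Sum>q'\<in>states ?N. trans ?N (Mec E) Tau q') = (\<Sum>q'\<in>states ?N. if q' = Bot then 1 else 0)"
        by (simp add: mec_quotient_def)
      also have "\<dots> = 1"
        using finite_states_mec_quotient[OF M] by (simp add: mec_quotient_def)
      finally show ?thesis
        unfolding Mec Tau by (simp add: mec_quotient_def)
    qed
  qed (simp add: mec_quotient_def)
  have "initial ?N \<in> states ?N"
    using quot_map_in_states[of "initial M" M] M by (simp add: is_mdp_def mec_quotient_def)
  moreover have "finite (acts ?N)"
    using M by (auto simp: is_mdp_def mec_quotient_def)
  ultimately show ?thesis
    unfolding is_mdp_def using row finite_states_mec_quotient[OF M] by blast
qed

end

(* Every state of the quotient reaches a terminal state under the given scheduler: a strongly
   connected set of states that is never left would lift to an end component of M, contradicting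
   the maximality of the collapsed components. Hence all frequencies in the quotient are finite.

   They prescribe the flow into and out of the states of each maximal end component E. If E has
   positive frequency and tau is not chosen there, the prescribed inflow and outflow of E have equal
   sums, and strong connectivity of E provides a positive circulation along the actions of E that
   makes up for the difference at each state. Choosing every action proportionally to its flow gives
   the memoryless scheduler for M, which never leaves the other components. Away from these it
   leaves almost surely, so its flow equations have a unique solution and its frequencies are the
   prescribed ones. *)
theory Submission
  imports Defs
begin

section \<open>Transient matrices and circulations\<close>

text \<open>An exit chosen in the quotient names the state from which the component is left, but a
  memoryless scheduler for \<open>M\<close> cannot remember that choice while walking to this state.
  Paths therefore cannot be matched, only expected frequencies, and the construction becomes linear
  algebra on flow equations. Two obstacles shape it. In a one-state component with a loop, a
  memoryless choice leaves almost surely or never, so probabilities of \<open>Tau\<close> strictly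
  between 0 and 1 cannot be imitated in general. And flow equations admit spurious solutions: mass
  circling in a part that is never entered satisfies them too. The circulation is made strictly
  positive on the whole component so that all its actions are used and every exit stays reachable;
  components of frequency zero are grouped with those where \<open>Tau\<close> is chosen, because a
  positive circulation there would be such a spurious solution. Transience is certified by a
  potential \<open>w\<close> with \<open>P w + 1 \<le> w\<close>, which gives both convergence of
  the series and uniqueness of the solution.\<close>

text \<open>The witness \<open>w\<close> bounds the expected time until \<open>X\<close> is left.\<close>

definition transient :: "'b set \<Rightarrow> ('b \<Rightarrow> 'b \<Rightarrow> real) \<Rightarrow> bool" where
  "transient X P \<longleftrightarrow> finite X \<and> (\<forall>s\<in>X. \<forall>t\<in>X. 0 \<le> P s t) \<and>
     (\<exists>w. \<forall>s\<in>X. 0 \<le> w s \<and> (\<Sum>t\<in>X. P s t * w t) + 1 \<le> w s)"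

text \<open>Pairing \<open>y\<close> with the witness \<open>w\<close> gives
  \<open>y w \<le> y P w \<le> y (w - 1)\<close>, so the total mass of \<open>y\<close> is at most
  0.\<close>

lemma transient_eq_0:
  assumes tr: "transient X P"
    and y: "\<And>t. t \<in> X \<Longrightarrow> 0 \<le> y t" "\<And>t. t \<in> X \<Longrightarrow> y t \<le> (\<Sum>s\<in>X. y s * P s t)"
    and t: "t \<in> X"
  shows "y t = 0"
proof -
  obtain w where w: "\<And>s. s \<in> X \<Longrightarrow> 0 \<le> w s" "\<And>s. s \<in> X \<Longrightarrow> (\<Sum>t\<in>X. P s t * w t) + 1 \<le> w s"
    using tr unfolding transient_def by blast
  have fin: "finite X" using tr by (simp add: transient_def)
  have "(\<Sum>t\<in>X. y t * w t) \<le> (\<Sum>t\<in>X. (\<Sum>s\<in>X. y s * P s t) * w t)"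
    by (intro sum_mono mult_right_mono y w)
  also have "\<dots> = (\<Sum>t\<in>X. \<Sum>s\<in>X. y s * (P s t * w t))"
    by (simp add: sum_distrib_right mult.assoc)
  also have "\<dots> = (\<Sum>s\<in>X. y s * (\<Sum>t\<in>X. P s t * w t))"
    by (subst sum.swap) (simp add: sum_distrib_left)
  also have "\<dots> \<le> (\<Sum>s\<in>X. y s * (w s - 1))"
    by (intro sum_mono mult_left_mono y) (use w(2) in force)
  also have "\<dots> = (\<Sum>s\<in>X. y s * w s) - (\<Sum>s\<in>X. y s)"
    by (simp add: right_diff_distrib sum_subtractf)
  finally have "(\<Sum>s\<in>X. y s) \<le> 0" by simp
  then show ?thesis
    using sum_nonneg_eq_0_iff[OF fin y(1)] sum_nonneg[of X y] y(1) t by force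
qed

text \<open>The absolute difference of two solutions is subinvariant, hence zero by
  \<open>transient_eq_0\<close>.\<close>

lemma transient_unique:
  assumes tr: "transient X P"
    and x: "\<And>t. t \<in> X \<Longrightarrow> x t = \<mu> t + (\<Sum>s\<in>X. x s * P s t)"
    and y: "\<And>t. t \<in> X \<Longrightarrow> y t = \<mu> t + (\<Sum>s\<in>X. y s * P s t)"
    and t: "t \<in> X"
  shows "x t = y t"
proof -
  have "\<bar>x t - y t\<bar> \<le> (\<Sum>s\<in>X. \<bar>x s - y s\<bar> * P s t)" if "t \<in> X" for t
  proof -
    have "x t - y t = (\<Sum>s\<in>X. (x s - y s) * P s t)"
      using x[OF that] y[OF that] by (simp add: left_diff_distrib sum_subtractf)
    also have "\<bar>\<dots>\<bar> \<le> (\<Sum>s\<in>X. \<bar>(x s - y s) * P s t\<bar>)" by (rule sum_abs)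
    also have "\<dots> = (\<Sum>s\<in>X. \<bar>x s - y s\<bar> * P s t)"
      using tr that by (intro sum.cong) (auto simp: transient_def abs_mult)
    finally show ?thesis .
  qed
  then have "\<bar>x t - y t\<bar> = 0"
    by (intro transient_eq_0[OF tr _ _ t]) auto
  then show ?thesis by simp
qed

text \<open>The pairing of \<open>a n\<close> with \<open>w\<close> drops in each step by at least
  the total mass of \<open>a n\<close>. Its initial value therefore bounds all partial sums.\<close>

lemma transient_iterate:
  assumes tr: "transient X P"
    and a0: "\<And>t. t \<in> X \<Longrightarrow> 0 \<le> a 0 t"
    and aS: "\<And>n t. t \<in> X \<Longrightarrow> a (Suc n) t = (\<Sum>s\<in>X. a n s * P s t)"
    and t: "t \<in> X"
  shows transient_iterate_nonneg: "0 \<le> a n t"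
    and transient_summable: "summable (\<lambda>n. a n t)"
proof -
  obtain w where w: "\<And>s. s \<in> X \<Longrightarrow> 0 \<le> w s" "\<And>s. s \<in> X \<Longrightarrow> (\<Sum>t\<in>X. P s t * w t) + 1 \<le> w s"
    using tr unfolding transient_def by blast
  have fin: "finite X" using tr by (simp add: transient_def)
  have nonneg: "\<forall>t\<in>X. 0 \<le> a n t" for n
  proof (induction n)
    case (Suc n)
    then show ?case using tr by (auto simp: aS transient_def intro!: sum_nonneg mult_nonneg_nonneg)
  qed (use a0 in auto)
  then show "0 \<le> a n t" using t by auto
  have bound: "(\<Sum>n<N. \<Sum>t\<in>X. a n t) + (\<Sum>t\<in>X. a N t * w t) \<le> (\<Sum>t\<in>X. a 0 t * w t)" for N
  proof (induction N)
    case (Suc N)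
    have "(\<Sum>t\<in>X. a (Suc N) t * w t) = (\<Sum>t\<in>X. \<Sum>s\<in>X. a N s * (P s t * w t))"
      by (simp add: aS sum_distrib_right mult.assoc)
    also have "\<dots> = (\<Sum>s\<in>X. a N s * (\<Sum>t\<in>X. P s t * w t))"
      by (subst sum.swap) (simp add: sum_distrib_left)
    also have "\<dots> \<le> (\<Sum>s\<in>X. a N s * (w s - 1))"
      using nonneg by (intro sum_mono mult_left_mono) (use w(2) in force)+
    also have "\<dots> = (\<Sum>s\<in>X. a N s * w s) - (\<Sum>s\<in>X. a N s)"
      by (simp add: right_diff_distrib sum_subtractf)
    finally show ?case using Suc by simp
  qed simp
  show "summable (\<lambda>n. a n t)"
  proof (rule summableI_nonneg_bounded)
    show "0 \<le> a n t" for n using nonneg t by auto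
    show "(\<Sum>n<N. a n t) \<le> (\<Sum>t\<in>X. a 0 t * w t)" for N
    proof -
      have "(\<Sum>n<N. a n t) \<le> (\<Sum>n<N. \<Sum>t\<in>X. a n t)"
        using nonneg t fin by (intro sum_mono member_le_sum) auto
      also have "\<dots> \<le> \<dots> + (\<Sum>t\<in>X. a N t * w t)"
        using nonneg w(1) by (simp add: sum_nonneg)
      also note bound
      finally show ?thesis .
    qed
  qed
qed

lemma transient_suminf:
  assumes tr: "transient X P"
    and a0: "\<And>t. t \<in> X \<Longrightarrow> 0 \<le> a 0 t"
    and aS: "\<And>n t. t \<in> X \<Longrightarrow> a (Suc n) t = (\<Sum>s\<in>X. a n s * P s t)"
    and t: "t \<in> X"
  shows "(\<Sum>n. a n t) = a 0 t + (\<Sum>s\<in>X. (\<Sum>n. a n s) * P s t)"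
proof -
  have sm: "summable (\<lambda>n. a n s)" if "s \<in> X" for s
    by (rule transient_summable[OF tr a0 aS that])
  have "(\<Sum>n. a n t) = a 0 t + (\<Sum>n. a (Suc n) t)"
    using suminf_split_head[OF sm[OF t]] by simp
  also have "(\<Sum>n. a (Suc n) t) = (\<Sum>s\<in>X. (\<Sum>n. a n s * P s t))"
    unfolding aS[OF t] by (rule suminf_sum) (auto intro: sm summable_mult2)
  also have "\<dots> = (\<Sum>s\<in>X. (\<Sum>n. a n s) * P s t)"
    by (intro sum.cong refl suminf_mult2[symmetric] sm)
  finally show ?thesis .
qed

text \<open>The solution is the Neumann series, the sum of the iterates of \<open>\<mu>\<close>
  under \<open>P\<close>.\<close>

lemma transient_solution:
  fixes \<mu> :: "'b \<Rightarrow> real"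
  assumes tr: "transient X P" and \<mu>: "\<And>t. t \<in> X \<Longrightarrow> 0 \<le> \<mu> t"
  obtains x where "\<And>t. t \<in> X \<Longrightarrow> 0 \<le> x t" "\<And>t. t \<in> X \<Longrightarrow> x t = \<mu> t + (\<Sum>s\<in>X. x s * P s t)"
proof -
  define a where "a n = rec_nat \<mu> (\<lambda>_ b t. \<Sum>s\<in>X. b s * P s t) n" for n
  have a: "a 0 = \<mu>" "a (Suc n) t = (\<Sum>s\<in>X. a n s * P s t)" for n t
    by (simp_all add: a_def)
  have a0: "0 \<le> a 0 t" if "t \<in> X" for t using that \<mu> by (simp add: a)
  show ?thesis
  proof (rule that[of "\<lambda>t. \<Sum>n. a n t"])
    show "0 \<le> (\<Sum>n. a n t)" if "t \<in> X" for t
      by (intro suminf_nonneg transient_summable[OF tr a0 a(2) that] transient_iterate_nonneg[OF tr a0 a(2) that])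
    show "(\<Sum>n. a n t) = \<mu> t + (\<Sum>s\<in>X. (\<Sum>n. a n s) * P s t)" if "t \<in> X" for t
      using transient_suminf[OF tr a0 a(2) that] by (simp add: a(1))
  qed
qed

text \<open>Let \<open>d\<close> be the distance to the outside of \<open>X\<close> along edges of
  positive weight. From each state of \<open>X\<close> some edge decreases \<open>d\<close>, with
  weight bounded below by a common \<open>p\<close>. A potential that is geometric in
  \<open>d\<close> with a small enough ratio then decreases on average, however the remaining mass
  moves.\<close>

lemma transientI:
  fixes P :: "'b \<Rightarrow> 'b \<Rightarrow> real"
  assumes fin: "finite S" and XS: "X \<subseteq> S"
    and nonneg: "\<And>s t. s \<in> X \<Longrightarrow> t \<in> S \<Longrightarrow> 0 \<le> P s t"
    and row: "\<And>s. s \<in> X \<Longrightarrow> (\<Sum>t\<in>S. P s t) \<le> 1"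
    and leave: "\<And>s. s \<in> X \<Longrightarrow> \<exists>t\<in>S - X. (s, t) \<in> {(u, v). u \<in> X \<and> v \<in> S \<and> 0 < P u v}\<^sup>*"
  shows "transient X P"
proof -
  define R where "R = {(u, v). u \<in> X \<and> v \<in> S \<and> 0 < P u v}"
  define d where "d s = (LEAST n. \<exists>t\<in>S - X. (s, t) \<in> R ^^ n)" for s
  have d0: "d s = 0" if "s \<in> S - X" for s
    unfolding d_def by (rule Least_eq_0) (use that in auto)
  have step: "\<exists>t\<in>S. 0 < P s t \<and> Suc (d t) = d s" if s: "s \<in> X" for s
  proof -
    obtain t where t: "t \<in> S - X" "(s, t) \<in> R\<^sup>*" using leave[OF s] unfolding R_def by blast
    then have ex: "\<exists>n. \<exists>t\<in>S - X. (s, t) \<in> R ^^ n" by (meson rtrancl_imp_relpow)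
    from LeastI_ex[OF ex] obtain t where t: "t \<in> S - X" "(s, t) \<in> R ^^ d s"
      unfolding d_def by blast
    then have "d s \<noteq> 0" using s by (cases "d s") auto
    then obtain m where m: "d s = Suc m" by (cases "d s") auto
    then obtain u where u: "(s, u) \<in> R" "(u, t) \<in> R ^^ m"
      using t(2) by (metis relpow_Suc_D2)
    have "d u \<le> m" unfolding d_def by (rule Least_le) (use u t in blast)
    moreover have "m \<le> d u"
    proof -
      have "\<exists>n. \<exists>t\<in>S - X. (u, t) \<in> R ^^ n" using u t by blast
      from LeastI_ex[OF this] obtain t' where "t' \<in> S - X" "(u, t') \<in> R ^^ d u"
        unfolding d_def by blast
      then have "\<exists>t\<in>S - X. (s, t) \<in> R ^^ Suc (d u)" using u(1) by (meson relpow_Suc_I2)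
      then have "d s \<le> Suc (d u)" unfolding d_def by (rule Least_le)
      then show ?thesis using m by simp
    qed
    ultimately show ?thesis using u(1) m by (auto simp: R_def)
  qed
  have finX: "finite X" using fin XS finite_subset by blast
  \<comment> \<open>Inserting 1 keeps the set nonempty when \<open>X\<close> is empty and gives
    \<open>p \<le> 1\<close>.\<close>
  define A where "A = insert 1 ((\<lambda>(s, t). P s t) ` {(s, t) \<in> X \<times> S. 0 < P s t})"
  have "finite {(s, t) \<in> X \<times> S. 0 < P s t}"
    using finX fin by (intro finite_subset[OF _ finite_cartesian_product[of X S]]) auto
  then have finA: "finite A" by (simp add: A_def)
  define p where "p = Min A"
  have p: "0 < p" "p \<le> 1"
    using finA Min_in[OF finA] Min_le[OF finA, of 1] by (auto simp: p_def A_def)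
  have p_le: "p \<le> P s t" if "s \<in> X" "t \<in> S" "0 < P s t" for s t
    unfolding p_def using finA that by (intro Min_le) (auto simp: A_def image_iff)
  \<comment> \<open>The average decrease below is proportional to \<open>p - l\<close>, so the ratio
    must be smaller than \<open>p\<close>. Halving makes this difference equal to \<open>l\<close>
    itself.\<close>
  define l where "l = p / 2"
  have l: "0 < l" "l < 1" "p - l = l" using p by (auto simp: l_def)
  define D where "D = (\<Sum>s\<in>X. d s)"
  have D: "d s \<le> D" if "s \<in> X" for s unfolding D_def using finX that by (simp add: member_le_sum)
  \<comment> \<open>The decrease at \<open>s\<close> will be \<open>c * l ^ d s\<close>; as
    \<open>D\<close> bounds all distances, this scaling makes it at least 1.\<close>
  define c where "c = 1 / l ^ D"
  have c: "0 < c" using l by (simp add: c_def)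
  define w where "w s = c * (1 - l ^ d s)" for s
  have w0: "0 \<le> w s" for s
    using c l by (simp add: w_def power_le_one)
  have "(\<Sum>t\<in>X. P s t * w t) + 1 \<le> w s" if s: "s \<in> X" for s
  proof -
    obtain u where u: "u \<in> S" "0 < P s u" "Suc (d u) = d s" using step[OF s] by blast
    \<comment> \<open>Outside \<open>X\<close> the distance is 0, where \<open>w\<close>
      vanishes.\<close>
    have "(\<Sum>t\<in>X. P s t * w t) = (\<Sum>t\<in>S. P s t * w t)"
      using fin XS by (intro sum.mono_neutral_left) (auto simp: w_def d0)
    also have "\<dots> = c * ((\<Sum>t\<in>S. P s t) - (\<Sum>t\<in>S. P s t * l ^ d t))"
      by (simp add: w_def sum_distrib_left algebra_simps flip: sum_subtractf)
    also have "\<dots> \<le> c * (1 - p * l ^ d u)"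
    proof (rule mult_left_mono)
      have "p * l ^ d u \<le> P s u * l ^ d u" using p_le[OF s u(1,2)] l by simp
      also have "\<dots> \<le> (\<Sum>t\<in>S. P s t * l ^ d t)"
        using fin u(1) nonneg[OF s] l by (intro member_le_sum) auto
      finally show "(\<Sum>t\<in>S. P s t) - (\<Sum>t\<in>S. P s t * l ^ d t) \<le> 1 - p * l ^ d u"
        using row[OF s] by simp
    qed (use c in simp)
    also have "\<dots> = w s - c * l ^ d u * (p - l)"
      by (simp add: w_def u(3)[symmetric] algebra_simps)
    finally have "(\<Sum>t\<in>X. P s t * w t) \<le> w s - c * l ^ d u * (p - l)" .
    moreover have "c * l ^ d u * (p - l) = l ^ d s / l ^ D"
      unfolding l(3) by (simp add: c_def u(3)[symmetric])
    moreover have "1 \<le> l ^ d s / l ^ D"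
      using l D[OF s] by (simp add: power_decreasing)
    ultimately show ?thesis by simp
  qed
  with w0 finX nonneg XS show ?thesis unfolding transient_def by blast
qed

text \<open>An equation \<open>x = b + x P\<close> with \<open>b\<close> of total 0 is solved by
  fixing the value at one state \<open>r\<close>: without \<open>r\<close> the irreducible chain is
  transient. This solution may have negative entries, which a large multiple of the positive
  invariant vector repairs without disturbing the equation.\<close>

lemma circulation_exists:
  fixes P :: "'b \<Rightarrow> 'b \<Rightarrow> real"
  assumes fin: "finite F" and ne: "F \<noteq> {}"
    and nonneg: "\<And>u v. u \<in> F \<Longrightarrow> v \<in> F \<Longrightarrow> 0 \<le> P u v"
    and row: "\<And>u. u \<in> F \<Longrightarrow> (\<Sum>v\<in>F. P u v) = 1"
    and irred: "\<And>u v. u \<in> F \<Longrightarrow> v \<in> F \<Longrightarrow> (u, v) \<in> {(u, v). u \<in> F \<and> v \<in> F \<and> 0 < P u v}\<^sup>*"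
    and bi: "\<And>v. v \<in> F \<Longrightarrow> 0 \<le> bi v" and bo: "\<And>v. v \<in> F \<Longrightarrow> 0 \<le> bo v"
    and bal: "sum bi F = sum bo F"
  obtains x where "\<And>v. v \<in> F \<Longrightarrow> 0 < x v"
    "\<And>v. v \<in> F \<Longrightarrow> x v + bo v = bi v + (\<Sum>u\<in>F. x u * P u v)"
proof -
  obtain r where r: "r \<in> F" using ne by blast
  define Y where "Y = F - {r}"
  have FY: "F = insert r Y" "r \<notin> Y" "finite Y" using r fin by (auto simp: Y_def)
  have tr: "transient Y P"
  proof (rule transientI[OF fin])
    fix s assume s: "s \<in> Y"
    let ?R = "{(u, v). u \<in> F \<and> v \<in> F \<and> 0 < P u v}" and ?R' = "{(u, v). u \<in> Y \<and> v \<in> F \<and> 0 < P u v}"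
    have "(s, r) \<in> ?R\<^sup>*" using irred s r by (auto simp: Y_def)
    \<comment> \<open>Only edges that start in \<open>Y\<close> are allowed, so the path is cut at
      its first visit to \<open>r\<close>.\<close>
    then have "(s, r) \<in> ?R'\<^sup>*"
    proof (induction rule: converse_rtrancl_induct)
      case (step y z)
      show ?case
      proof (cases "y = r")
        case False
        then have "(y, z) \<in> ?R'" using step by (auto simp: Y_def)
        then show ?thesis using step.IH by (rule converse_rtrancl_into_rtrancl)
      qed auto
    qed auto
    then show "\<exists>t\<in>F - Y. (s, t) \<in> ?R'\<^sup>*" using r by (intro bexI[of _ r]) (auto simp: Y_def)
  qed (use nonneg row in \<open>auto simp: Y_def\<close>)
  \<comment> \<open>The balance equation at \<open>r\<close> is the sum of all the others, since the rows of \<open>P\<close> sum to 1.\<close>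
  have at_r: "x r = b r + (\<Sum>u\<in>F. x u * P u r)"
    if "\<And>v. v \<in> Y \<Longrightarrow> x v = b v + (\<Sum>u\<in>F. x u * P u v)" and "sum b F = 0" for x b :: "'b \<Rightarrow> real"
  proof -
    have "(\<Sum>v\<in>F. \<Sum>u\<in>F. x u * P u v) = (\<Sum>v\<in>F. x v)"
      by (subst sum.swap) (simp add: row flip: sum_distrib_left)
    then have "(\<Sum>v\<in>F. x v - (b v + (\<Sum>u\<in>F. x u * P u v))) = 0"
      using that(2) by (simp add: sum_subtractf sum.distrib)
    also have "(\<Sum>v\<in>F. x v - (b v + (\<Sum>u\<in>F. x u * P u v))) = x r - (b r + (\<Sum>u\<in>F. x u * P u r))"
      using FY(2,3) by (subst (1) FY(1), subst sum.insert) (auto simp: that(1)[symmetric])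
    finally show ?thesis by simp
  qed
  obtain xi where xi: "\<And>t. t \<in> Y \<Longrightarrow> xi t = bi t + (\<Sum>s\<in>Y. xi s * P s t)"
    by (rule transient_solution[OF tr, of bi]) (use bi in \<open>auto simp: Y_def\<close>)
  obtain xo where xo: "\<And>t. t \<in> Y \<Longrightarrow> xo t = bo t + (\<Sum>s\<in>Y. xo s * P s t)"
    by (rule transient_solution[OF tr, of bo]) (use bo in \<open>auto simp: Y_def\<close>)
  obtain p where p: "\<And>t. t \<in> Y \<Longrightarrow> 0 \<le> p t" "\<And>t. t \<in> Y \<Longrightarrow> p t = P r t + (\<Sum>s\<in>Y. p s * P s t)"
    by (rule transient_solution[OF tr, of "P r"]) (use nonneg r in \<open>auto simp: Y_def\<close>)
  \<comment> \<open>For \<open>v\<close> in \<open>Y\<close>, the value \<open>p v\<close>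
    represents the expected number of visits to \<open>v\<close> between two visits to
    \<open>r\<close>. This is the classical invariant vector, normalised at
    \<open>r\<close>.\<close>
  define \<pi> where "\<pi> = p(r := 1)"
  have \<pi>Y: "\<pi> v = 0 + (\<Sum>u\<in>F. \<pi> u * P u v)" if "v \<in> Y" for v
  proof -
    have "(\<Sum>s\<in>Y. p s * P s v) = (\<Sum>s\<in>Y. \<pi> s * P s v)" using FY(2) by (intro sum.cong) (auto simp: \<pi>_def)
    then show ?thesis using p(2)[OF that] that FY(2,3) unfolding FY(1) by (auto simp: \<pi>_def)
  qed
  have \<pi>: "\<pi> v = (\<Sum>u\<in>F. \<pi> u * P u v)" if "v \<in> F" for v
    using \<pi>Y at_r[of \<pi> "\<lambda>_. 0", OF \<pi>Y] that unfolding FY(1) by auto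
  have \<pi>_nonneg: "0 \<le> \<pi> v" if "v \<in> F" for v using that p(1) by (auto simp: \<pi>_def Y_def)
  \<comment> \<open>Positivity spreads from \<open>r\<close> along the edges of the chain.\<close>
  have \<pi>_pos: "0 < \<pi> v" if v: "v \<in> F" for v
    using irred[OF r v]
  proof (induction rule: rtrancl_induct)
    case (step y z)
    then have "0 < \<pi> y * P y z" by auto
    also have "\<dots> \<le> (\<Sum>u\<in>F. \<pi> u * P u z)"
      using step(2) fin \<pi>_nonneg nonneg by (intro member_le_sum[of y F "\<lambda>u. \<pi> u * P u z"]) auto
    finally show ?case using \<pi>[of z] step(2) by simp
  qed (simp add: \<pi>_def)
  \<comment> \<open>\<open>transient_solution\<close> takes nonnegative sources only, so the source
    \<open>bi - bo\<close> is treated as a difference of two.\<close>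
  define x0 where "x0 = (\<lambda>v. if v = r then 0 else xi v - xo v)"
  have x0Y: "x0 v = (bi v - bo v) + (\<Sum>u\<in>F. x0 u * P u v)" if "v \<in> Y" for v
  proof -
    have "(\<Sum>u\<in>F. x0 u * P u v) = (\<Sum>u\<in>Y. (xi u - xo u) * P u v)"
      unfolding FY(1) using FY(2,3) by (auto simp: x0_def intro!: sum.cong)
    then show ?thesis using xi[OF that] xo[OF that] that FY(2)
      by (auto simp: x0_def left_diff_distrib sum_subtractf)
  qed
  have x0: "x0 v = (bi v - bo v) + (\<Sum>u\<in>F. x0 u * P u v)" if "v \<in> F" for v
    using x0Y at_r[of x0 "\<lambda>v. bi v - bo v", OF x0Y] bal that unfolding FY(1)
    by (auto simp: sum_subtractf)
  \<comment> \<open>The sum of the ratios bounds each of them, and the added 1 makes the bound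
    strict.\<close>
  define C where "C = (\<Sum>v\<in>F. \<bar>x0 v\<bar> / \<pi> v) + 1"
  show thesis
  proof (rule that[of "\<lambda>v. x0 v + C * \<pi> v"])
    fix v assume v: "v \<in> F"
    have "\<bar>x0 v\<bar> / \<pi> v \<le> (\<Sum>v\<in>F. \<bar>x0 v\<bar> / \<pi> v)"
      using fin v \<pi>_nonneg by (intro member_le_sum) auto
    then have "\<bar>x0 v\<bar> / \<pi> v < C" by (simp add: C_def)
    then show "0 < x0 v + C * \<pi> v" using \<pi>_pos[OF v] by (simp add: field_simps)
    have "(\<Sum>u\<in>F. (x0 u + C * \<pi> u) * P u v) = (\<Sum>u\<in>F. x0 u * P u v) + C * \<pi> v"
      by (subst \<pi>[OF v]) (simp add: distrib_right sum.distrib sum_distrib_left mult.assoc)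
    then show "x0 v + C * \<pi> v + bo v = bi v + (\<Sum>u\<in>F. (x0 u + C * \<pi> u) * P u v)"
      using x0[OF v] by simp
  qed
qed

section \<open>Expected frequencies as sums of occupation probabilities\<close>

lemma pmf_of_weights:
  fixes w :: "'b \<Rightarrow> real"
  assumes fin: "finite A" and nonneg: "\<And>a. a \<in> A \<Longrightarrow> 0 \<le> w a" and sum: "sum w A = 1"
  obtains p where "set_pmf p \<subseteq> A" "\<And>a. a \<in> A \<Longrightarrow> pmf p a = w a"
proof -
  let ?w = "\<lambda>a. if a \<in> A then w a else 0"
  have "(\<integral>\<^sup>+a. ennreal (?w a) \<partial>count_space UNIV) = (\<Sum>a\<in>A. ennreal (?w a))"
    by (rule nn_integral_count_space'[OF fin]) auto
  also have "\<dots> = ennreal (sum ?w A)"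
    using nonneg by (subst sum_ennreal) auto
  also have "sum ?w A = 1" using sum by simp
  finally have one: "(\<integral>\<^sup>+a. ennreal (?w a) \<partial>count_space UNIV) = 1" by simp
  have pmf: "pmf (embed_pmf ?w) a = ?w a" for a
    using one nonneg by (intro pmf_embed_pmf) auto
  show thesis
  proof (rule that[of "embed_pmf ?w"])
    show "set_pmf (embed_pmf ?w) \<subseteq> A" by (auto simp: set_pmf_iff pmf split: if_splits)
  qed (simp add: pmf)
qed

lemma pmf_eq_0_if_other_1: "pmf p x = 1 \<Longrightarrow> y \<noteq> x \<Longrightarrow> pmf p y = 0"
  using measure_pmf.prob_le_1[of p "{x, y}"] pmf_nonneg[of p y]
  by (simp add: measure_measure_pmf_finite)

section \<open>Occupation probabilities of states and laws of single steps\<close>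

definition trans_under :: "('s, 'a) mdp \<Rightarrow> ('s \<Rightarrow> 'a pmf) \<Rightarrow> 's \<Rightarrow> 's \<Rightarrow> real" where
  "trans_under M \<sigma> s t =
     (if terminal M s then 0 else \<Sum>\<alpha>\<in>enabled M s. pmf (\<sigma> s) \<alpha> * trans M s \<alpha> t)"

text \<open>At a terminal state, \<open>occupation\<close> gives the probability of arriving there at time \<open>n\<close>.\<close>

primrec occupation :: "('s, 'a) mdp \<Rightarrow> ('s \<Rightarrow> 'a pmf) \<Rightarrow> nat \<Rightarrow> 's \<Rightarrow> real" where
  "occupation M \<sigma> 0 t = (if t = initial M then 1 else 0)"
| "occupation M \<sigma> (Suc n) t = (\<Sum>s\<in>states M. occupation M \<sigma> n s * trans_under M \<sigma> s t)"

text \<open>The law of the \<open>n\<close>-th coordinate of a path, as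
  \<open>nn_integral_path_measure\<close> confirms. The padding at terminal states is still included
  here.\<close>

primrec step_distr :: "('s, 'a) mdp \<Rightarrow> ('s \<Rightarrow> 'a pmf) \<Rightarrow> nat \<Rightarrow> 's \<times> 'a option \<Rightarrow> real" where
  "step_distr M \<sigma> 0 y = (if fst y = initial M then choice_prob M \<sigma> (fst y) (snd y) else 0)"
| "step_distr M \<sigma> (Suc n) y = (\<Sum>x\<in>steps M. step_distr M \<sigma> n x * step_prob M \<sigma> x y)"

lemma step_distr_nonneg: "is_mdp M \<Longrightarrow> y \<in> steps M \<Longrightarrow> 0 \<le> step_distr M \<sigma> n y"
  by (induction n arbitrary: y)
     (auto intro!: sum_nonneg mult_nonneg_nonneg step_prob_nonneg choice_prob_nonneg)

lemma steps_eq: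
  "steps M = (SIGMA s:states M. if terminal M s then {None} else Some ` enabled M s)"
  by (auto simp: steps_def terminal_def split: if_splits)

lemma trans_nonneg: "is_mdp M \<Longrightarrow> s \<in> states M \<Longrightarrow> \<alpha> \<in> enabled M s \<Longrightarrow> t \<in> states M \<Longrightarrow> 0 \<le> trans M s \<alpha> t"
  by (auto simp: is_mdp_def enabled_def)

lemma trans_under_nonneg:
  "is_mdp M \<Longrightarrow> s \<in> states M \<Longrightarrow> t \<in> states M \<Longrightarrow> 0 \<le> trans_under M \<sigma> s t"
  by (auto simp: trans_under_def intro!: sum_nonneg mult_nonneg_nonneg trans_nonneg)

lemma finite_enabled: "is_mdp M \<Longrightarrow> finite (enabled M s)"
  by (auto simp: is_mdp_def enabled_def)

lemma sum_pmf_enabled: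
  assumes "is_mdp M" "mr_scheduler M \<sigma>" "s \<in> states M" "\<not> terminal M s"
  shows "(\<Sum>\<alpha>\<in>enabled M s. pmf (\<sigma> s) \<alpha>) = 1"
  using assms by (intro sum_pmf_eq_1) (auto simp: mr_scheduler_def finite_enabled)

lemma sum_trans_under:
  assumes "is_mdp M" "mr_scheduler M \<sigma>" "s \<in> states M" "\<not> terminal M s"
  shows "(\<Sum>t\<in>states M. trans_under M \<sigma> s t) = 1"
proof -
  have "(\<Sum>t\<in>states M. trans_under M \<sigma> s t) =
      (\<Sum>\<alpha>\<in>enabled M s. pmf (\<sigma> s) \<alpha> * (\<Sum>t\<in>states M. trans M s \<alpha> t))"
    using assms by (simp add: trans_under_def sum_distrib_left) (rule sum.swap)
  also have "\<dots> = (\<Sum>\<alpha>\<in>enabled M s. pmf (\<sigma> s) \<alpha>)"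
    by (intro sum.cong) (auto simp: enabled_def)
  finally show ?thesis using sum_pmf_enabled[OF assms] by simp
qed

lemma trans_under_pos_iff:
  assumes "is_mdp M" "s \<in> states M" "t \<in> states M"
  shows "0 < trans_under M \<sigma> s t \<longleftrightarrow> (\<exists>\<alpha>\<in>enabled M s. 0 < pmf (\<sigma> s) \<alpha> \<and> 0 < trans M s \<alpha> t)"
proof -
  have *: "0 < trans_under M \<sigma> s t \<longleftrightarrow> (\<exists>\<alpha>\<in>enabled M s. pmf (\<sigma> s) \<alpha> * trans M s \<alpha> t \<noteq> 0)"
  proof (cases "terminal M s")
    case False
    have nn: "\<And>\<alpha>. \<alpha> \<in> enabled M s \<Longrightarrow> 0 \<le> pmf (\<sigma> s) \<alpha> * trans M s \<alpha> t"
      using assms by (intro mult_nonneg_nonneg trans_nonneg) auto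
    show ?thesis
      using sum_nonneg_eq_0_iff[OF finite_enabled[OF assms(1)] nn] sum_nonneg[OF nn] False
      by (auto simp: trans_under_def less_le)
  qed (auto simp: trans_under_def terminal_def)
  show ?thesis unfolding *
    using assms trans_nonneg[OF assms(1,2) _ assms(3)] by (fastforce simp: less_le)
qed

text \<open>Given the current state, the action is drawn independently of the past. Padded pairs
  \<open>(u, None)\<close> only repeat themselves and feed no pair with an action, which matches the
  zero rows of \<open>trans_under\<close> at terminal states.\<close>

lemma step_distr_Some:
  assumes M: "is_mdp M" and s: "s \<in> states M" and \<alpha>: "\<alpha> \<in> enabled M s"
  shows "step_distr M \<sigma> n (s, Some \<alpha>) = occupation M \<sigma> n s * pmf (\<sigma> s) \<alpha>"
  using s \<alpha>
proof (induction n arbitrary: s \<alpha>)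
  case 0
  then show ?case by (auto simp: choice_prob_def terminal_def)
next
  case (Suc n)
  have nt: "\<not> terminal M s" using Suc.prems by (auto simp: terminal_def)
  have fin: "finite (states M)" "finite (if terminal M u then {None} else Some ` enabled M u)" for u
    using M finite_enabled[OF M] by (auto simp: is_mdp_def)
  have "step_distr M \<sigma> (Suc n) (s, Some \<alpha>) =
      (\<Sum>u\<in>states M. \<Sum>b\<in>(if terminal M u then {None} else Some ` enabled M u).
         step_distr M \<sigma> n (u, b) * step_prob M \<sigma> (u, b) (s, Some \<alpha>))"
    unfolding step_distr.simps steps_eq
    by (subst sum.Sigma) (auto simp: fin case_prod_beta)
  also have "\<dots> = (\<Sum>u\<in>states M. occupation M \<sigma> n u * trans_under M \<sigma> u s * pmf (\<sigma> s) \<alpha>)"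
  proof (rule sum.cong[OF refl])
    fix u assume u: "u \<in> states M"
    show "(\<Sum>b\<in>(if terminal M u then {None} else Some ` enabled M u).
         step_distr M \<sigma> n (u, b) * step_prob M \<sigma> (u, b) (s, Some \<alpha>)) =
       occupation M \<sigma> n u * trans_under M \<sigma> u s * pmf (\<sigma> s) \<alpha>"
    proof (cases "terminal M u")
      case True
      then show ?thesis by (simp add: trans_under_def step_prob_def)
    next
      case False
      then show ?thesis using Suc.IH[OF u] nt
        by (auto simp: trans_under_def step_prob_def choice_prob_def sum.reindex sum_distrib_left
            sum_distrib_right intro!: sum.cong)
    qed
  qed
  also have "\<dots> = occupation M \<sigma> (Suc n) s * pmf (\<sigma> s) \<alpha>"
    by (simp add: sum_distrib_right)
  finally show ?case .
qed

text \<open>A function of one coordinate sees only a finite-dimensional marginal of the projective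
  limit, and this marginal unfolds kernel by kernel into a matrix recursion.\<close>

lemma nn_integral_path_measure:
  fixes g :: "'s \<times> 'a option \<Rightarrow> ennreal"
  assumes M: "is_mdp M" and \<sigma>: "mr_scheduler M \<sigma>"
  shows "(\<integral>\<^sup>+\<omega>. g (\<omega> n) \<partial>path_measure M \<sigma>) = (\<Sum>y\<in>steps M. ennreal (step_distr M \<sigma> n y) * g y)"
proof -
  let ?N = "\<lambda>_::nat. count_space (steps M)"
  interpret IT: Ionescu_Tulcea "step_kernel M \<sigma>" ?N
    by (rule Ionescu_Tulcea_step_kernel[OF M \<sigma>])
  note fin = finite_steps[OF M]
  have meas: "(\<lambda>\<omega>. h (\<omega> n)) \<in> borel_measurable (PiM I ?N)"
    if "n \<in> I" for I and h :: "'s \<times> 'a option \<Rightarrow> ennreal" and n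
    by (rule measurable_compose[OF measurable_component_singleton[OF that]]) simp
  have u: "(\<lambda>_. undefined) \<in> space (PiM {0..<0} ?N)" by (simp add: space_PiM)
  \<comment> \<open>Coordinate \<open>n\<close> is produced by the last of the first
    \<open>Suc n\<close> kernels, so integrating it out leaves one kernel applied to the
    history.\<close>
  have step: "(\<integral>\<^sup>+\<omega>. h (\<omega> n) \<partial>IT.C 0 (Suc n) (\<lambda>_. undefined)) =
      (\<integral>\<^sup>+\<omega>. (\<integral>\<^sup>+x. h x \<partial>step_kernel M \<sigma> n \<omega>) \<partial>IT.C 0 n (\<lambda>_. undefined))"
    for n and h :: "'s \<times> 'a option \<Rightarrow> ennreal"
  proof -
    have "(\<integral>\<^sup>+\<omega>. h (\<omega> n) \<partial>IT.C 0 (Suc n) (\<lambda>_. undefined)) =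
        (\<integral>\<^sup>+\<omega>. (\<integral>\<^sup>+\<omega>'. h (\<omega>' n) \<partial>IT.eP n \<omega>) \<partial>IT.C 0 n (\<lambda>_. undefined))"
      unfolding IT.C.simps add_0
    proof (rule nn_integral_bind)
      show "(\<lambda>\<omega>. h (\<omega> n)) \<in> borel_measurable (PiM {0..<Suc n} ?N)" by (rule meas) simp
      show "IT.eP n \<in> measurable (IT.C 0 n (\<lambda>_. undefined)) (subprob_algebra (PiM {0..<Suc n} ?N))"
        using IT.measurable_eP[of n] by (simp add: measurable_cong_sets[OF IT.sets_C[OF u] refl])
    qed
    also have "\<dots> = (\<integral>\<^sup>+\<omega>. (\<integral>\<^sup>+x. h x \<partial>step_kernel M \<sigma> n \<omega>) \<partial>IT.C 0 n (\<lambda>_. undefined))"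
      by (intro nn_integral_cong) (simp add: IT.space_C[OF u] IT.nn_integral_eP meas)
    finally show ?thesis .
  qed
  have C: "(\<integral>\<^sup>+\<omega>. h (\<omega> n) \<partial>IT.C 0 (Suc n) (\<lambda>_. undefined)) =
      (\<Sum>y\<in>steps M. ennreal (step_distr M \<sigma> n y) * h y)" for n and h :: "'s \<times> 'a option \<Rightarrow> ennreal"
  proof (induction n arbitrary: h)
    case 0
    show ?case
      unfolding step step_kernel.simps nn_integral_point_measure_finite[OF fin]
      by (simp add: IT.space_C[OF u] prob_space.emeasure_space_1[OF IT.prob_space_C[OF u]] nn_integral_return)
  next
    case (Suc n)
    have "(\<integral>\<^sup>+\<omega>. h (\<omega> (Suc n)) \<partial>IT.C 0 (Suc (Suc n)) (\<lambda>_. undefined)) =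
      (\<integral>\<^sup>+\<omega>. (\<Sum>y\<in>steps M. ennreal (step_prob M \<sigma> (\<omega> n) y) * h y) \<partial>IT.C 0 (Suc n) (\<lambda>_. undefined))"
      unfolding step[where n="Suc n"] step_kernel.simps nn_integral_point_measure_finite[OF fin] ..
    also have "\<dots> = (\<Sum>x\<in>steps M. ennreal (step_distr M \<sigma> n x) * (\<Sum>y\<in>steps M. ennreal (step_prob M \<sigma> x y) * h y))"
      by (rule Suc.IH)
    also have "\<dots> = (\<Sum>y\<in>steps M. (\<Sum>x\<in>steps M. ennreal (step_distr M \<sigma> n x) * ennreal (step_prob M \<sigma> x y)) * h y)"
      by (simp add: sum_distrib_left sum_distrib_right mult.assoc) (rule sum.swap)
    also have "\<dots> = (\<Sum>y\<in>steps M. ennreal (step_distr M \<sigma> (Suc n) y) * h y)"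
      by (intro sum.cong refl arg_cong2[where f="(*)"])
         (simp add: step_distr_nonneg[OF M] step_prob_nonneg[OF M] flip: ennreal_mult)
    finally show ?case .
  qed
  \<comment> \<open>The marginal at index \<open>n\<close> is taken from the coordinates
    \<open>0\<close> to \<open>n\<close>, hence the shift by one.\<close>
  have up: "IT.up_to {n} = Suc n"
    unfolding IT.up_to_def by (rule Least_equality) (auto simp: not_less_eq_eq[symmetric])
  have "(\<integral>\<^sup>+\<omega>. g (\<omega> n) \<partial>path_measure M \<sigma>) = (\<integral>\<^sup>+\<omega>. g (\<omega> n) \<partial>IT.CI {n})"
    unfolding path_measure_def
    by (subst IT.distr_lim[symmetric], simp, subst nn_integral_distr)
       (auto intro!: meas measurable_restrict simp: measurable_cong_sets[OF IT.PF.sets_lim refl])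
  also have "\<dots> = (\<integral>\<^sup>+\<omega>. g (\<omega> n) \<partial>IT.C 0 (Suc n) (\<lambda>_. undefined))"
    unfolding IT.CI_def up
    by (subst nn_integral_distr)
       (auto intro!: meas measurable_restrict simp: measurable_cong_sets[OF IT.sets_C[OF u] refl] simp del: IT.C.simps)
  also note C
  finally show ?thesis .
qed

text \<open>Monotone convergence exchanges the integral with the count. The series stays in
  \<open>ennreal\<close> because actions inside end components may have infinite frequency.\<close>

lemma expected_frequency_eq:
  assumes M: "is_mdp M" and \<sigma>: "mr_scheduler M \<sigma>"
  shows "expected_frequency M \<sigma> \<alpha> =
    (\<Sum>n. \<Sum>s\<in>{s \<in> states M. \<alpha> \<in> enabled M s}. ennreal (occupation M \<sigma> n s * pmf (\<sigma> s) \<alpha>))"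
proof -
  let ?g = "\<lambda>y. if snd y = Some \<alpha> then 1 else 0 :: ennreal"
  interpret IT: Ionescu_Tulcea "step_kernel M \<sigma>" "\<lambda>_::nat. count_space (steps M)"
    by (rule Ionescu_Tulcea_step_kernel[OF M \<sigma>])
  have meas: "(\<lambda>\<omega>. ?g (\<omega> n)) \<in> borel_measurable (path_measure M \<sigma>)" for n
    unfolding path_measure_def measurable_cong_sets[OF IT.PF.sets_lim refl]
    by (rule measurable_compose[OF measurable_component_singleton[of n]]) simp_all
  have "expected_frequency M \<sigma> \<alpha> = (\<Sum>n. \<integral>\<^sup>+\<omega>. ?g (\<omega> n) \<partial>path_measure M \<sigma>)"
    unfolding expected_frequency_def by (rule nn_integral_suminf[OF meas])
  also have "(\<lambda>n. \<integral>\<^sup>+\<omega>. ?g (\<omega> n) \<partial>path_measure M \<sigma>) =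
     (\<lambda>n. \<Sum>s\<in>{s \<in> states M. \<alpha> \<in> enabled M s}. ennreal (occupation M \<sigma> n s * pmf (\<sigma> s) \<alpha>))"
  proof (rule ext)
    fix n
    let ?A = "{s \<in> states M. \<alpha> \<in> enabled M s}"
    have "(\<integral>\<^sup>+\<omega>. ?g (\<omega> n) \<partial>path_measure M \<sigma>) = (\<Sum>y\<in>steps M. ennreal (step_distr M \<sigma> n y) * ?g y)"
      by (rule nn_integral_path_measure[OF M \<sigma>])
    also have "\<dots> = (\<Sum>y\<in>(\<lambda>s. (s, Some \<alpha>)) ` ?A. ennreal (step_distr M \<sigma> n y) * ?g y)"
      by (intro sum.mono_neutral_right finite_steps[OF M]) (auto simp: steps_def)
    also have "\<dots> = (\<Sum>s\<in>?A. ennreal (occupation M \<sigma> n s * pmf (\<sigma> s) \<alpha>))"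
      by (subst sum.reindex) (auto simp: inj_on_def step_distr_Some[OF M])
    finally show "(\<integral>\<^sup>+\<omega>. ?g (\<omega> n) \<partial>path_measure M \<sigma>) =
      (\<Sum>s\<in>?A. ennreal (occupation M \<sigma> n s * pmf (\<sigma> s) \<alpha>))" .
  qed
  finally show ?thesis .
qed

section \<open>Frequencies in the quotient are finite\<close>

lemma mec_pairD:
  assumes "mec M E" "(s, \<alpha>) \<in> E"
  shows "s \<in> states M" "\<alpha> \<in> enabled M s" "\<And>t. t \<in> states M \<Longrightarrow> 0 < trans M s \<alpha> t \<Longrightarrow> t \<in> fst ` E"
proof -
  have "\<forall>(s, \<alpha>)\<in>E. s \<in> states M \<and> \<alpha> \<in> enabled M s \<and>
        (\<forall>t\<in>states M. trans M s \<alpha> t > 0 \<longrightarrow> t \<in> fst ` E)"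
    using assms(1) by (simp add: mec_def end_component_def)
  then show "s \<in> states M" "\<alpha> \<in> enabled M s" "\<And>t. t \<in> states M \<Longrightarrow> 0 < trans M s \<alpha> t \<Longrightarrow> t \<in> fst ` E"
    using assms(2) by blast+
qed

lemma mec_connected:
  "mec M E \<Longrightarrow> s \<in> fst ` E \<Longrightarrow> t \<in> fst ` E \<Longrightarrow>
    (s, t) \<in> {(u, v). v \<in> states M \<and> (\<exists>\<alpha>. (u, \<alpha>) \<in> E \<and> trans M u \<alpha> v > 0)}\<^sup>*"
  unfolding mec_def end_component_def by blast

lemma end_component_subset_mec:
  assumes M: "is_mdp M" and E: "end_component M E"
  obtains F where "mec M F" "E \<subseteq> F"
proof -
  have "{F. end_component M F} \<subseteq> Pow (states M \<times> acts M)"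
    by (auto simp: end_component_def enabled_def)
  then have "finite {F. end_component M F}"
    using M by (auto simp: is_mdp_def intro: finite_subset)
  from finite_has_maximal2[OF this, of E] E
  obtain F where F: "end_component M F" "E \<subseteq> F" "\<forall>F'. end_component M F' \<longrightarrow> F \<subseteq> F' \<longrightarrow> F = F'"
    by auto
  show thesis by (rule that[of F]) (use F in \<open>auto simp: mec_def\<close>)
qed

lemma quot_map_eq_Mec_iff: "mec M E \<Longrightarrow> quot_map M s = Mec E \<longleftrightarrow> s \<in> fst ` E"
proof
  assume E: "mec M E" and s: "quot_map M s = Mec E"
  then have "s \<in> mec_states M" by (auto simp: quot_map_def split: if_splits)
  then obtain F where F: "mec M F" "s \<in> fst ` F" by (auto simp: mec_states_def)
  then show "s \<in> fst ` E" using quot_map_Mec[OF F] s by simp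
qed (rule quot_map_Mec)

lemma quot_map_eq_Orig_iff: "quot_map M s = Orig t \<longleftrightarrow> s = t \<and> s \<notin> mec_states M"
  by (auto simp: quot_map_def)

lemma quot_map_neq_Bot: "quot_map M s \<noteq> Bot"
  by (auto simp: quot_map_def)

lemma quot_map_cases:
  obtains "s \<notin> mec_states M" "quot_map M s = Orig s"
    | E where "mec M E" "s \<in> fst ` E" "quot_map M s = Mec E"
proof (cases "s \<in> mec_states M")
  case True
  then obtain E where "mec M E" "s \<in> fst ` E" by (auto simp: mec_states_def)
  then show thesis using that(2) quot_map_Mec by metis
qed (use that(1) in \<open>simp add: quot_map_def\<close>)

text \<open>Exits of components and actions of states outside all components are treated alike:
  these pairs correspond to the enabled actions of the quotient other than
  \<open>Tau\<close>.\<close>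

definition external :: "('s, 'a) mdp \<Rightarrow> ('s \<times> 'a) set" where
  "external M = {(s, \<alpha>). s \<in> states M \<and> \<alpha> \<in> enabled M s \<and> (\<forall>E. mec M E \<longrightarrow> (s, \<alpha>) \<notin> E)}"

lemma finite_external: "is_mdp M \<Longrightarrow> finite (external M)"
  by (rule finite_subset[of _ "states M \<times> acts M"]) (auto simp: external_def enabled_def is_mdp_def)

lemma external_non_mec:
  assumes "s \<notin> mec_states M"
  shows "(s, \<alpha>) \<in> external M \<longleftrightarrow> s \<in> states M \<and> \<alpha> \<in> enabled M s"
proof -
  have "(s, \<alpha>) \<notin> E" if "mec M E" for E
    using assms that by (auto simp: mec_states_def rev_image_eqI)
  then show ?thesis by (simp add: external_def)
qed

lemma exits_iff:
  assumes E: "mec M E"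
  shows "(u, \<alpha>) \<in> exits M E \<longleftrightarrow> (u, \<alpha>) \<in> external M \<and> u \<in> fst ` E"
proof
  assume ex: "(u, \<alpha>) \<in> exits M E"
  have "(u, \<alpha>) \<notin> F" if F: "mec M F" for F
  proof
    assume "(u, \<alpha>) \<in> F"
    then have "u \<in> fst ` F" by (rule image_eqI[rotated]) simp
    then have "E = F" using ex mec_unique[OF E F, of u] by (simp add: exits_def)
    then show False using ex \<open>(u, \<alpha>) \<in> F\<close> by (simp add: exits_def)
  qed
  then show "(u, \<alpha>) \<in> external M \<and> u \<in> fst ` E"
    using ex exits_in_states[OF E ex] by (simp add: external_def exits_def)
next
  assume "(u, \<alpha>) \<in> external M \<and> u \<in> fst ` E"
  then show "(u, \<alpha>) \<in> exits M E" using E by (simp add: external_def exits_def)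
qed

section \<open>Actions and transitions of the quotient\<close>

locale quotient_scheduler =
  fixes M :: "('s, 'a) mdp" and \<sigma> :: "('s, 'a) qstate \<Rightarrow> 'a qact pmf"
  assumes mdp: "is_mdp M"
    and disjoint: "\<And>s t. s \<in> states M \<Longrightarrow> t \<in> states M \<Longrightarrow> s \<noteq> t \<Longrightarrow> enabled M s \<inter> enabled M t = {}"
    and sched: "mr_scheduler (mec_quotient M) \<sigma>"
begin

abbreviation N where "N \<equiv> mec_quotient M"
abbreviation \<iota> where "\<iota> \<equiv> quot_map M"

lemma mdp_N: "is_mdp N"
  using mdp disjoint by (rule is_mdp_mec_quotient)

lemma external_inj: "(s, \<alpha>) \<in> external M \<Longrightarrow> (t, \<alpha>) \<in> external M \<Longrightarrow> s = t"
  using disjoint[of s t] by (auto simp: external_def)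

lemma trans_N_external:
  assumes "(s, \<alpha>) \<in> external M"
  shows "trans N (\<iota> s) (Act \<alpha>) = trans_quot M s \<alpha>"
proof (cases rule: quot_map_cases[of s M])
  case 1
  then show ?thesis by (simp add: mec_quotient_def)
next
  case (2 E)
  then have ex: "(s, \<alpha>) \<in> exits M E" using assms by (simp add: exits_iff)
  then have "\<alpha> \<in> snd ` exits M E" by force
  then show ?thesis using 2 the_exit[OF disjoint 2(1) ex] by (simp add: mec_quotient_def)
qed

lemma Act_enabled_external:
  assumes "(s, \<alpha>) \<in> external M"
  shows "Act \<alpha> \<in> enabled N (\<iota> s)"
proof -
  have "(\<Sum>q\<in>states N. trans N (\<iota> s) (Act \<alpha>) q) = 1"
    using assms unfolding trans_N_external[OF assms] sum_trans_quot[OF mdp]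
    by (simp add: external_def enabled_def)
  moreover have "Act \<alpha> \<in> acts N" using assms by (simp add: external_def enabled_def mec_quotient_def)
  ultimately show ?thesis by (simp add: enabled_def)
qed

lemma Tau_enabled: "mec M E \<Longrightarrow> Tau \<in> enabled N (Mec E)"
proof -
  assume "mec M E"
  have "(\<Sum>q'\<in>states N. trans N (Mec E) Tau q') = (\<Sum>q'\<in>states N. if q' = Bot then 1 else 0)"
    by (simp add: mec_quotient_def)
  also have "\<dots> = 1"
    using finite_states_mec_quotient[OF mdp] by (simp add: mec_quotient_def)
  finally show ?thesis by (simp add: enabled_def mec_quotient_def)
qed

text \<open>Together with \<open>external_inj\<close>, this replaces sums over the actions of the
  quotient by sums over external pairs of \<open>M\<close>.\<close>

lemma enabled_N_cases:
  assumes q: "q \<in> states N" and a: "a \<in> enabled N q"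
  obtains s \<alpha> where "(s, \<alpha>) \<in> external M" "\<iota> s = q" "a = Act \<alpha>"
    | E where "mec M E" "q = Mec E" "a = Tau"
proof (cases q)
  case (Orig s)
  then have s: "s \<in> states M" "s \<notin> mec_states M" using q by (auto simp: mec_quotient_def)
  have sum: "(\<Sum>q'\<in>states N. trans N q a q') = 1" using a by (simp add: enabled_def)
  show thesis
  proof (cases a)
    case (Act \<alpha>)
    then have "\<alpha> \<in> acts M" using a by (auto simp: enabled_def mec_quotient_def)
    moreover have "(\<Sum>t\<in>states M. trans M s \<alpha> t) = 1"
      using sum unfolding Orig Act by (simp add: mec_quotient_def sum_trans_quot[OF mdp, unfolded mec_quotient_def, simplified])
    ultimately have "\<alpha> \<in> enabled M s" by (simp add: enabled_def)
    then show thesis using that(1)[of s \<alpha>] s Act Orig by (simp add: external_non_mec quot_map_eq_Orig_iff)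
  next
    case Tau
    then show thesis using sum Orig by (simp add: mec_quotient_def)
  qed
next
  case (Mec E)
  then have E: "mec M E" using q by (auto simp: mec_quotient_def)
  show thesis
  proof (cases a)
    case (Act \<alpha>)
    have "\<alpha> \<in> snd ` exits M E"
    proof (rule ccontr)
      assume "\<alpha> \<notin> snd ` exits M E"
      then have "(\<Sum>q'\<in>states N. trans N q a q') = 0" using Mec Act by (simp add: mec_quotient_def)
      then show False using a by (simp add: enabled_def)
    qed
    then obtain u where "(u, \<alpha>) \<in> exits M E" by force
    then show thesis using that(1)[of u \<alpha>] E Mec Act by (simp add: exits_iff quot_map_Mec)
  qed (use that(2) E Mec in auto)
next
  case Bot
  then show thesis using a by (simp add: enabled_def mec_quotient_def)
qed

lemma states_N_cases:
  assumes "q \<in> states N"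
  obtains s where "s \<in> states M" "\<iota> s = q" | "q = Bot"
proof (cases q)
  case (Orig s)
  then show thesis using assms that(1)[of s] by (auto simp: mec_quotient_def quot_map_eq_Orig_iff)
next
  case (Mec E)
  then have E: "mec M E" using assms by (auto simp: mec_quotient_def)
  then obtain s \<alpha> where "(s, \<alpha>) \<in> E" by (auto simp: mec_def end_component_def)
  then show thesis using that(1)[of s] mec_pairD(1)[OF E] quot_map_Mec[OF E] Mec by force
qed (use that in auto)

lemma terminal_Bot: "terminal N Bot"
  by (auto simp: terminal_def enabled_def mec_quotient_def)

lemma not_terminal_Mec: "mec M E \<Longrightarrow> \<not> terminal N (Mec E)"
  using Tau_enabled by (auto simp: terminal_def)

lemma terminal_quot_map_iff: "s \<in> states M \<Longrightarrow> terminal N (\<iota> s) \<longleftrightarrow> terminal M s"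
proof (cases rule: quot_map_cases[of s M])
  case 1
  assume s: "s \<in> states M"
  show ?thesis
  proof
    assume "terminal N (\<iota> s)"
    then show "terminal M s"
      using Act_enabled_external[of s] s 1 by (auto simp: terminal_def external_non_mec)
  next
    assume t: "terminal M s"
    show "terminal N (\<iota> s)"
    proof (rule ccontr)
      assume "\<not> terminal N (\<iota> s)"
      then obtain a where a: "a \<in> enabled N (\<iota> s)" by (auto simp: terminal_def)
      show False
        by (rule enabled_N_cases[OF quot_map_in_states[OF s] a])
           (use 1 t in \<open>auto simp: quot_map_eq_Orig_iff external_def terminal_def\<close>)
    qed
  qed
next
  case (2 E)
  then obtain \<alpha> where "(s, \<alpha>) \<in> E" by force
  then show ?thesis using 2 mec_pairD(2)[OF 2(1)] not_terminal_Mec[OF 2(1)] by (auto simp: terminal_def)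
qed

lemma trans_quot_pos:
  assumes "(s, \<alpha>) \<in> external M" "t \<in> states M" "0 < trans M s \<alpha> t"
  shows "0 < trans_quot M s \<alpha> (\<iota> t)"
proof -
  have "trans M s \<alpha> t \<le> trans_quot M s \<alpha> (\<iota> t)"
    unfolding trans_quot_def using assms mdp trans_nonneg[OF mdp]
    by (intro member_le_sum) (auto simp: external_def is_mdp_def)
  then show ?thesis using assms by simp
qed

text \<open>Lifts an edge of the quotient to a step of \<open>M\<close>. Its source \<open>u\<close>
  is dictated by the action and may be any state of the fibre of \<open>q\<close>.\<close>

lemma quot_step:
  assumes q: "q \<in> states N" "q' \<in> states N" "q' \<noteq> Bot" and pos: "0 < trans_under N \<sigma> q q'"
  obtains u \<alpha> t where "(u, \<alpha>) \<in> external M" "\<iota> u = q" "0 < pmf (\<sigma> q) (Act \<alpha>)"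
    "t \<in> states M" "\<iota> t = q'" "0 < trans M u \<alpha> t"
proof -
  obtain a where a: "a \<in> enabled N q" "0 < pmf (\<sigma> q) a" "0 < trans N q a q'"
    using pos trans_under_pos_iff[OF mdp_N q(1,2)] by blast
  show thesis
  proof (rule enabled_N_cases[OF q(1) a(1)])
    fix u \<alpha> assume u: "(u, \<alpha>) \<in> external M" "\<iota> u = q" "a = Act \<alpha>"
    then have "0 < trans_quot M u \<alpha> q'" using a(3) trans_N_external[OF u(1)] by simp
    then have "(\<Sum>t\<in>{t \<in> states M. \<iota> t = q'}. trans M u \<alpha> t) > 0" by (simp add: trans_quot_def)
    then obtain t where "t \<in> states M" "\<iota> t = q'" "0 < trans M u \<alpha> t"
      using sum_nonpos[of "{t \<in> states M. \<iota> t = q'}" "trans M u \<alpha>"] by force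
    then show thesis using that u a(2) by blast
  next
    fix E assume "mec M E" "q = Mec E" "a = Tau"
    then show thesis using a(3) q(3) by (simp add: mec_quotient_def)
  qed
qed

section \<open>Reachability of terminal states in the quotient\<close>

definition edges :: "(('s, 'a) qstate \<times> ('s, 'a) qstate) set" where
  "edges = {(q, q'). q \<in> states N \<and> \<not> terminal N q \<and> q' \<in> states N \<and> 0 < trans_under N \<sigma> q q'}"

text \<open>Otherwise some bottom strongly connected set \<open>B\<close> has no terminal state. The
  scheduler cannot use \<open>Tau\<close> in \<open>B\<close>, so it uses an external action in each
  of its states. These actions would join the end component lifted from \<open>B\<close>, although
  external actions lie in no maximal end component.\<close>

lemma terminal_reachable:
  assumes q0: "q0 \<in> states N"
  shows "\<exists>q\<in>states N. terminal N q \<and> (q0, q) \<in> edges\<^sup>*"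
proof (rule ccontr)
  assume no: "\<not> ?thesis"
  define reach where "reach q = edges\<^sup>* `` {q}" for q
  have reach_states: "reach q \<subseteq> states N" if "q \<in> states N" for q
  proof
    fix x assume "x \<in> reach q"
    then have "(q, x) \<in> edges\<^sup>*" by (simp add: reach_def)
    then show "x \<in> states N" by (induction rule: rtrancl_induct) (use that in \<open>auto simp: edges_def\<close>)
  qed
  have finN: "finite (states N)" using mdp_N by (simp add: is_mdp_def)
  \<comment> \<open>A reachability set of minimal size is strongly connected.\<close>
  define q1 where "q1 = arg_min (\<lambda>q. card (reach q)) (\<lambda>q. q \<in> reach q0)"
  have "q0 \<in> reach q0" by (simp add: reach_def)
  note q1 = arg_min_natI[of "\<lambda>q. q \<in> reach q0", OF this, of "\<lambda>q. card (reach q)", folded q1_def]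
  have q1_le: "card (reach q1) \<le> card (reach q)" if "q \<in> reach q0" for q
    unfolding q1_def by (rule arg_min_nat_le) (rule that)
  define B where "B = reach q1"
  have B_states: "B \<subseteq> states N" using reach_states q1 q0 unfolding B_def by blast
  have q1B: "q1 \<in> B" by (simp add: B_def reach_def)
  have B0: "B \<subseteq> reach q0" using q1 by (auto simp: B_def reach_def)
  have B_closed: "q' \<in> B" if "q \<in> B" "(q, q') \<in> edges\<^sup>*" for q q'
    using that by (auto simp: B_def reach_def)
  have B_conn: "(q, q') \<in> edges\<^sup>*" if "q \<in> B" "q' \<in> B" for q q'
  proof -
    have "reach q \<subseteq> B" using that(1) by (auto simp: B_def reach_def)
    moreover have "card B \<le> card (reach q)" using q1_le[of q] that B0 by (auto simp: B_def)
    moreover have "finite B" using B_states finN finite_subset by blast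
    ultimately have "reach q = B" by (metis card_seteq)
    then show ?thesis using that(2) by (auto simp: reach_def)
  qed
  have B_nonterminal: "\<not> terminal N q" if "q \<in> B" for q
    using no that B0 B_states by (auto simp: reach_def)
  have B_Bot: "Bot \<notin> B" using B_nonterminal terminal_Bot by blast
  have B_edge: "(q, q') \<in> edges" if "q \<in> B" "q' \<in> states N" "0 < trans_under N \<sigma> q q'" for q q'
    using that B_nonterminal B_states by (auto simp: edges_def)
  \<comment> \<open>Choosing \<open>Tau\<close> with positive probability would put the terminal
    state \<open>Bot\<close> into \<open>B\<close>.\<close>
  have no_Tau: "pmf (\<sigma> q) Tau = 0" if q: "q \<in> B" "q = Mec E" for q E
  proof (rule ccontr)
    assume "pmf (\<sigma> q) Tau \<noteq> 0"
    then have pos: "0 < pmf (\<sigma> q) Tau" by (simp add: pmf_pos)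
    have E: "mec M E" using q B_states by (auto simp: mec_quotient_def)
    have Bot: "Bot \<in> states N" by (simp add: mec_quotient_def)
    have "trans N q Tau Bot = 1" using q by (simp add: mec_quotient_def)
    moreover have qN: "q \<in> states N" using q(1) B_states by blast
    moreover have "Tau \<in> enabled N q" using Tau_enabled[OF E] q(2) by simp
    ultimately have "0 < trans_under N \<sigma> q Bot"
      unfolding trans_under_pos_iff[OF mdp_N qN Bot] by (intro bexI[of _ Tau]) (simp_all add: pos)
    then have "Bot \<in> B" using B_edge[OF q(1) Bot] B_closed[OF q(1)] by blast
    then show False using B_Bot by simp
  qed
  have support: "\<exists>u \<alpha>. (u, \<alpha>) \<in> external M \<and> \<iota> u = q \<and> 0 < pmf (\<sigma> q) (Act \<alpha>)" if q: "q \<in> B" for q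
  proof -
    have qN: "q \<in> states N" using q B_states by auto
    obtain a where a: "a \<in> set_pmf (\<sigma> q)" using set_pmf_not_empty[of "\<sigma> q"] by blast
    then have "a \<in> enabled N q" using sched qN B_nonterminal[OF q] by (auto simp: mr_scheduler_def)
    with qN show ?thesis
    proof (cases rule: enabled_N_cases)
      case (1 s \<alpha>)
      then show ?thesis using pmf_positive[OF a] by blast
    next
      case (2 E)
      then show ?thesis using no_Tau[OF q 2(2)] a by (simp add: set_pmf_iff)
    qed
  qed
  \<comment> \<open>The lift of \<open>B\<close> keeps all actions inside the collapsed components,
    which connect each fibre, and adds the external actions that the scheduler actually
    uses.\<close>
  define E' where "E' = {(s, \<alpha>). s \<in> states M \<and> \<iota> s \<in> B \<and> \<alpha> \<in> enabled M s \<and>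
     ((\<exists>E. mec M E \<and> (s, \<alpha>) \<in> E) \<or> 0 < pmf (\<sigma> (\<iota> s)) (Act \<alpha>))}"
  let ?R = "{(u, v). v \<in> states M \<and> (\<exists>\<alpha>. (u, \<alpha>) \<in> E' \<and> trans M u \<alpha> v > 0)}"
  have mec_sub: "E \<subseteq> E'" if E: "mec M E" "Mec E \<in> B" for E
  proof clarify
    fix s \<alpha> assume s: "(s, \<alpha>) \<in> E"
    then have "s \<in> fst ` E" by force
    with s show "(s, \<alpha>) \<in> E'"
      using mec_pairD(1,2)[OF E(1) s] quot_map_Mec[OF E(1)] E by (auto simp: E'_def)
  qed
  have E'_states: "s \<in> fst ` E'" if s: "s \<in> states M" "\<iota> s \<in> B" for s
  proof (cases rule: quot_map_cases[of s M])
    case 1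
    obtain u \<alpha> where "(u, \<alpha>) \<in> external M" "\<iota> u = \<iota> s" "0 < pmf (\<sigma> (\<iota> s)) (Act \<alpha>)"
      using support[OF s(2)] by blast
    moreover from this have "u = s" using 1 by (simp add: quot_map_eq_Orig_iff)
    ultimately have "(s, \<alpha>) \<in> E'" using s by (simp add: E'_def external_def)
    then show ?thesis by force
  next
    case (2 E)
    then show ?thesis using mec_sub[of E] s by auto
  qed
  have closed: "t \<in> fst ` E'" if s: "(s, \<alpha>) \<in> E'" "t \<in> states M" "0 < trans M s \<alpha> t" for s \<alpha> t
  proof (cases "\<exists>E. mec M E \<and> (s, \<alpha>) \<in> E")
    case True
    then obtain E where E: "mec M E" "(s, \<alpha>) \<in> E" by blast
    then have "s \<in> fst ` E" by force
    then have "Mec E \<in> B" using quot_map_Mec[OF E(1), of s] s(1) by (simp add: E'_def)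
    then show ?thesis using mec_sub[OF E(1)] mec_pairD(3)[OF E s(2,3)] by blast
  next
    case False
    then have ext: "(s, \<alpha>) \<in> external M" and sB: "\<iota> s \<in> B" and p: "0 < pmf (\<sigma> (\<iota> s)) (Act \<alpha>)"
      using s by (auto simp: E'_def external_def)
    have "0 < trans N (\<iota> s) (Act \<alpha>) (\<iota> t)"
      using trans_quot_pos[OF ext s(2,3)] trans_N_external[OF ext] by simp
    moreover have "\<iota> s \<in> states N" using sB B_states by blast
    ultimately have "0 < trans_under N \<sigma> (\<iota> s) (\<iota> t)"
      using trans_under_pos_iff[OF mdp_N _ quot_map_in_states[OF s(2)]] Act_enabled_external[OF ext] p
      by metis
    then have "(\<iota> s, \<iota> t) \<in> edges" by (rule B_edge[OF sB quot_map_in_states[OF s(2)]])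
    then have "\<iota> t \<in> B" using B_closed[OF sB r_into_rtrancl] by simp
    then show ?thesis using E'_states s(2) by blast
  qed
  have fibre: "(s, t) \<in> ?R\<^sup>*" if st: "s \<in> states M" "\<iota> s \<in> B" "\<iota> s = \<iota> t" for s t
  proof (cases rule: quot_map_cases[of s M])
    case 1
    then have "\<iota> t = Orig s" using st(3) by metis
    then have "t = s" by (simp add: quot_map_eq_Orig_iff)
    then show ?thesis by simp
  next
    case (2 E)
    then have "(s, t) \<in> {(u, v). v \<in> states M \<and> (\<exists>\<alpha>. (u, \<alpha>) \<in> E \<and> trans M u \<alpha> v > 0)}\<^sup>*"
      using st(3) 2 quot_map_eq_Mec_iff[OF 2(1), of t] by (intro mec_connected) auto
    moreover have "E \<subseteq> E'" using mec_sub[OF 2(1)] 2(3) st(2) by simp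
    then have "{(u, v). v \<in> states M \<and> (\<exists>\<alpha>. (u, \<alpha>) \<in> E \<and> trans M u \<alpha> v > 0)}\<^sup>* \<subseteq> ?R\<^sup>*"
      by (intro rtrancl_mono) blast
    ultimately show ?thesis by blast
  qed
  have conn: "(s, t) \<in> ?R\<^sup>*" if st: "s \<in> states M" "\<iota> s \<in> B" "t \<in> states M" "\<iota> t \<in> B" for s t
  proof -
    have "(\<iota> s, \<iota> t) \<in> edges\<^sup>*" using B_conn st by blast
    \<comment> \<open>The claim is generalised to the whole fibre: a lifted edge starts and ends at
      prescribed states, and \<open>fibre\<close> bridges the gaps between consecutive
      edges.\<close>
    then have "\<forall>s'. s' \<in> states M \<longrightarrow> \<iota> s' = \<iota> s \<longrightarrow> \<iota> s' \<in> B \<longrightarrow> (s', t) \<in> ?R\<^sup>*"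
    proof (induction rule: converse_rtrancl_induct)
      case base
      then show ?case using fibre by simp
    next
      case (step q q')
      show ?case
      proof (intro allI impI)
        fix s' assume s': "s' \<in> states M" "\<iota> s' = q" "\<iota> s' \<in> B"
        have e: "(\<iota> s', q') \<in> edges" using step s' by simp
        then have "q' \<in> B" using B_closed s' by blast
        then have "q' \<noteq> Bot" using B_Bot by blast
        then obtain u \<alpha> t' where u: "(u, \<alpha>) \<in> external M" "\<iota> u = \<iota> s'" "0 < pmf (\<sigma> (\<iota> s')) (Act \<alpha>)"
          "t' \<in> states M" "\<iota> t' = q'" "0 < trans M u \<alpha> t'"
          using e by (auto simp: edges_def elim: quot_step)
        have "(s', u) \<in> ?R\<^sup>*" using fibre s' u by simp
        also have "(u, \<alpha>) \<in> E'" using u s' by (auto simp: E'_def external_def)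
        then have "(u, t') \<in> ?R" using u by auto
        also have "(t', t) \<in> ?R\<^sup>*" using step.IH u \<open>q' \<in> B\<close> by simp
        finally show "(s', t) \<in> ?R\<^sup>*" .
      qed
    qed
    then show ?thesis using st by blast
  qed
  obtain s1 where s1: "s1 \<in> states M" "\<iota> s1 = q1"
    using states_N_cases[of q1] q1B B_states B_Bot by blast
  have "end_component M E'"
    unfolding end_component_def
  proof (intro conjI)
    show "E' \<noteq> {}" using E'_states[of s1] s1 q1B by auto
    show "\<forall>(s, \<alpha>)\<in>E'. s \<in> states M \<and> \<alpha> \<in> enabled M s \<and>
        (\<forall>t\<in>states M. trans M s \<alpha> t > 0 \<longrightarrow> t \<in> fst ` E')"
      using closed by (auto simp: E'_def)
    show "\<forall>s\<in>fst ` E'. \<forall>t\<in>fst ` E'. (s, t) \<in> ?R\<^sup>*"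
      using conn by (auto simp: E'_def)
  qed
  \<comment> \<open>As \<open>F\<close> contains the lift, \<open>q1\<close> must be the collapsed
    \<open>F\<close>. The external action used there belongs to \<open>E'\<close> and hence to
    \<open>F\<close>, which is absurd.\<close>
  then obtain F where F: "mec M F" "E' \<subseteq> F" by (rule end_component_subset_mec[OF mdp])
  have "s1 \<in> fst ` F" using E'_states[of s1] s1 q1B F by auto
  then have "Mec F \<in> B" using quot_map_Mec[OF F(1)] s1 q1B by auto
  then obtain u \<alpha> where "(u, \<alpha>) \<in> external M" "\<iota> u = Mec F" "0 < pmf (\<sigma> (Mec F)) (Act \<alpha>)"
    using support by blast
  then have "(u, \<alpha>) \<in> E'" "(u, \<alpha>) \<notin> F" using \<open>Mec F \<in> B\<close> F(1) by (auto simp: E'_def external_def)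
  then show False using F(2) by blast
qed

section \<open>State frequencies of the quotient\<close>

definition nonterm where "nonterm = {q \<in> states N. \<not> terminal N q}"

lemma nonterm_quot_map:
  assumes "s \<in> states M" "\<not> terminal M s"
  shows "\<iota> s \<in> nonterm"
  using assms by (simp add: nonterm_def quot_map_in_states terminal_quot_map_iff)

lemma nonterm_external: "(s, \<alpha>) \<in> external M \<Longrightarrow> \<iota> s \<in> nonterm"
  by (rule nonterm_quot_map) (auto simp: external_def terminal_def)

lemma transient_N: "transient nonterm (trans_under N \<sigma>)"
proof (rule transientI)
  show "finite (states N)" using mdp_N by (simp add: is_mdp_def)
  show "nonterm \<subseteq> states N" by (auto simp: nonterm_def)
  show "0 \<le> trans_under N \<sigma> s t" if "s \<in> nonterm" "t \<in> states N" for s t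
    using that by (auto simp: nonterm_def intro: trans_under_nonneg[OF mdp_N])
  show "(\<Sum>t\<in>states N. trans_under N \<sigma> s t) \<le> 1" if "s \<in> nonterm" for s
    using that sum_trans_under[OF mdp_N sched] by (simp add: nonterm_def)
  show "\<exists>t\<in>states N - nonterm. (s, t) \<in> {(u, v). u \<in> nonterm \<and> v \<in> states N \<and> 0 < trans_under N \<sigma> u v}\<^sup>*"
    if s: "s \<in> nonterm" for s
  proof -
    have eq: "{(u, v). u \<in> nonterm \<and> v \<in> states N \<and> 0 < trans_under N \<sigma> u v} = edges"
      by (auto simp: edges_def nonterm_def)
    obtain t where "t \<in> states N" "terminal N t" "(s, t) \<in> edges\<^sup>*"
      using terminal_reachable[of s] s by (auto simp: nonterm_def)
    then show ?thesis unfolding eq by (auto simp: nonterm_def)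
  qed
qed

lemma occupation_N_Suc:
  "occupation N \<sigma> (Suc n) q' = (\<Sum>q\<in>nonterm. occupation N \<sigma> n q * trans_under N \<sigma> q q')"
  unfolding occupation.simps
  using mdp_N by (intro sum.mono_neutral_right) (auto simp: is_mdp_def nonterm_def trans_under_def)

lemma occupation_0_nonneg: "0 \<le> occupation K \<tau> 0 q"
  by simp

definition freq where "freq q = (\<Sum>n. occupation N \<sigma> n q)"

lemma summable_occupation_N: "q \<in> nonterm \<Longrightarrow> summable (\<lambda>n. occupation N \<sigma> n q)"
  by (rule transient_summable[OF transient_N occupation_0_nonneg occupation_N_Suc])

lemma occupation_N_nonneg: "q \<in> nonterm \<Longrightarrow> 0 \<le> occupation N \<sigma> n q"
  by (rule transient_iterate_nonneg[OF transient_N occupation_0_nonneg occupation_N_Suc])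

lemma freq_nonneg: "q \<in> nonterm \<Longrightarrow> 0 \<le> freq q"
  unfolding freq_def by (intro suminf_nonneg summable_occupation_N occupation_N_nonneg)

lemma freq_eq:
  "q' \<in> nonterm \<Longrightarrow> freq q' = occupation N \<sigma> 0 q' + (\<Sum>q\<in>nonterm. freq q * trans_under N \<sigma> q q')"
  unfolding freq_def
  by (rule transient_suminf[OF transient_N occupation_0_nonneg occupation_N_Suc])

subsection \<open>Flow between and inside the components\<close>

text \<open>This turns out to be the frequency of \<open>Act \<alpha>\<close> in the quotient, the
  value that the lifted scheduler must reproduce.\<close>

definition flow where "flow s \<alpha> = freq (\<iota> s) * pmf (\<sigma> (\<iota> s)) (Act \<alpha>)"

text \<open>An exit that leads back into its own component counts as a new entry, in accordance with
  \<open>freq\<close>, which counts each return to the collapsed state.\<close>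

definition inflow where
  "inflow t = (if t = initial M then 1 else 0) + (\<Sum>(s, \<alpha>)\<in>external M. flow s \<alpha> * trans M s \<alpha> t)"

definition outflow where "outflow s = (\<Sum>\<alpha>\<in>{\<alpha>. (s, \<alpha>) \<in> external M}. flow s \<alpha>)"

lemma flow_nonneg: "(s, \<alpha>) \<in> external M \<Longrightarrow> 0 \<le> flow s \<alpha>"
  by (simp add: flow_def freq_nonneg nonterm_external)

lemma finite_external_at: "finite {\<alpha>. (s, \<alpha>) \<in> external M}"
  by (rule finite_subset[OF _ finite_enabled[OF mdp, of s]]) (auto simp: external_def)

lemma outflow_nonneg: "0 \<le> outflow s"
  unfolding outflow_def by (intro sum_nonneg flow_nonneg) simp

lemma inflow_nonneg: "t \<in> states M \<Longrightarrow> 0 \<le> inflow t"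
  unfolding inflow_def
  by (intro add_nonneg_nonneg sum_nonneg)
     (auto simp: external_def intro!: mult_nonneg_nonneg trans_nonneg[OF mdp] flow_nonneg)

text \<open>\<open>Tau\<close> leads only to \<open>Bot\<close>, so the flow into a nonterminal
  state comes from external pairs alone.\<close>

lemma freq_inflow:
  assumes q': "q' \<in> nonterm"
  shows "freq q' = (if q' = \<iota> (initial M) then 1 else 0) +
    (\<Sum>(s, \<alpha>)\<in>external M. flow s \<alpha> * trans_quot M s \<alpha> q')"
proof -
  let ?h = "\<lambda>(q, a). freq q * (pmf (\<sigma> q) a * trans N q a q')"
  let ?j = "\<lambda>(s, \<alpha>). (\<iota> s, Act \<alpha>)"
  have Bot: "q' \<noteq> Bot" using q' terminal_Bot by (auto simp: nonterm_def)
  have fin: "finite nonterm" using mdp_N by (simp add: is_mdp_def nonterm_def)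
  have "(\<Sum>q\<in>nonterm. freq q * trans_under N \<sigma> q q') =
      (\<Sum>q\<in>nonterm. \<Sum>a\<in>enabled N q. ?h (q, a))"
    by (intro sum.cong refl) (simp add: trans_under_def nonterm_def sum_distrib_left)
  also have "\<dots> = (\<Sum>x\<in>Sigma nonterm (enabled N). ?h x)"
    by (subst sum.Sigma) (simp_all add: fin finite_enabled[OF mdp_N])
  also have "\<dots> = (\<Sum>x\<in>?j ` external M. ?h x)"
  proof (rule sum.mono_neutral_right)
    show "finite (Sigma nonterm (enabled N))"
      using fin finite_enabled[OF mdp_N] by (rule finite_SigmaI)
    show "?j ` external M \<subseteq> Sigma nonterm (enabled N)"
      using nonterm_external Act_enabled_external by auto
    show "\<forall>x\<in>Sigma nonterm (enabled N) - ?j ` external M. ?h x = 0"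
    proof
      fix x assume x: "x \<in> Sigma nonterm (enabled N) - ?j ` external M"
      obtain q a where qa: "x = (q, a)" by (cases x)
      have q: "q \<in> states N" "a \<in> enabled N q" using x qa by (auto simp: nonterm_def)
      show "?h x = 0"
      proof (rule enabled_N_cases[OF q])
        fix s \<alpha> assume "(s, \<alpha>) \<in> external M" "\<iota> s = q" "a = Act \<alpha>"
        then have "x \<in> ?j ` external M" unfolding qa by (intro image_eqI[of _ _ "(s, \<alpha>)"]) simp_all
        then show ?thesis using x by blast
      next
        fix E assume "mec M E" "q = Mec E" "a = Tau"
        then show ?thesis using Bot by (simp add: qa mec_quotient_def)
      qed
    qed
  qed
  also have "\<dots> = (\<Sum>(s, \<alpha>)\<in>external M. flow s \<alpha> * trans_quot M s \<alpha> q')"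
  proof (subst sum.reindex)
    show "inj_on ?j (external M)"
      by (auto simp: inj_on_def dest: external_inj)
    show "sum (?h \<circ> ?j) (external M) = (\<Sum>(s, \<alpha>)\<in>external M. flow s \<alpha> * trans_quot M s \<alpha> q')"
      by (intro sum.cong refl) (auto simp: flow_def trans_N_external)
  qed
  finally show ?thesis
    using freq_eq[OF q'] by (simp add: mec_quotient_def)
qed

lemma sum_inflow:
  assumes q: "q \<in> nonterm"
  shows "(\<Sum>t\<in>{t \<in> states M. \<iota> t = q}. inflow t) = freq q"
proof -
  let ?F = "{t \<in> states M. \<iota> t = q}"
  have fin: "finite ?F" using mdp by (simp add: is_mdp_def)
  have init: "initial M \<in> states M" using mdp by (simp add: is_mdp_def)
  have "(\<Sum>t\<in>?F. inflow t) = (\<Sum>t\<in>?F. if t = initial M then 1 else 0) +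
      (\<Sum>t\<in>?F. \<Sum>x\<in>external M. flow (fst x) (snd x) * trans M (fst x) (snd x) t)"
    by (simp add: inflow_def sum.distrib case_prod_beta)
  also have "(\<Sum>t\<in>?F. if t = initial M then 1 else 0) = (if q = \<iota> (initial M) then 1 else 0 :: real)"
    using fin init by (simp add: eq_commute)
  also have "(\<Sum>t\<in>?F. \<Sum>x\<in>external M. flow (fst x) (snd x) * trans M (fst x) (snd x) t) =
      (\<Sum>x\<in>external M. flow (fst x) (snd x) * trans_quot M (fst x) (snd x) q)"
    by (subst sum.swap) (simp add: trans_quot_def sum_distrib_left)
  finally show ?thesis
    using freq_inflow[OF q] by (simp add: case_prod_beta)
qed

lemma Mec_nonterm: "mec M E \<Longrightarrow> Mec E \<in> nonterm"
  using not_terminal_Mec by (auto simp: nonterm_def mec_quotient_def)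

lemma mec_states_subset: "mec M E \<Longrightarrow> fst ` E \<subseteq> states M"
  using mec_pairD(1) by fastforce

lemma finite_mec:
  assumes "mec M E"
  shows "finite E"
proof (rule finite_subset)
  show "E \<subseteq> states M \<times> acts M" using mec_pairD(1,2)[OF assms] by (auto simp: enabled_def)
  show "finite (states M \<times> acts M)" using mdp by (simp add: is_mdp_def)
qed

lemma sum_inflow_mec:
  assumes E: "mec M E"
  shows "(\<Sum>t\<in>fst ` E. inflow t) = freq (Mec E)"
proof -
  have "{t \<in> states M. \<iota> t = Mec E} = fst ` E"
    using quot_map_eq_Mec_iff[OF E] mec_states_subset[OF E] by blast
  then show ?thesis using sum_inflow[OF Mec_nonterm[OF E]] by simp
qed

text \<open>Without \<open>Tau\<close> the exits carry the whole probability at the collapsed state,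
  so it is left as often as it is visited. With \<open>sum_inflow_mec\<close> this balances the
  demand on the circulation.\<close>

lemma sum_outflow_mec:
  assumes E: "mec M E" and tau: "pmf (\<sigma> (Mec E)) Tau = 0"
  shows "(\<Sum>s\<in>fst ` E. outflow s) = freq (Mec E)"
proof -
  let ?A = "SIGMA s:fst ` E. {\<alpha>. (s, \<alpha>) \<in> external M}"
  have \<iota>: "\<iota> s = Mec E" if "s \<in> fst ` E" for s using quot_map_Mec[OF E that] .
  have N: "Mec E \<in> states N" "\<not> terminal N (Mec E)"
    using Mec_nonterm[OF E] by (auto simp: nonterm_def)
  have "(\<Sum>s\<in>fst ` E. outflow s) = (\<Sum>x\<in>?A. flow (fst x) (snd x))"
    unfolding outflow_def using finite_mec[OF E]
    by (subst sum.Sigma) (auto simp: finite_external_at case_prod_beta)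
  also have "\<dots> = (\<Sum>x\<in>?A. freq (Mec E) * pmf (\<sigma> (Mec E)) (Act (snd x)))"
  proof (intro sum.cong refl)
    fix x assume "x \<in> ?A"
    then have "fst x \<in> fst ` E" by (cases x) simp
    then show "flow (fst x) (snd x) = freq (Mec E) * pmf (\<sigma> (Mec E)) (Act (snd x))"
      by (simp add: flow_def \<iota>)
  qed
  also have "\<dots> = freq (Mec E) * (\<Sum>x\<in>?A. pmf (\<sigma> (Mec E)) (Act (snd x)))"
    by (simp add: sum_distrib_left)
  also have "(\<Sum>x\<in>?A. pmf (\<sigma> (Mec E)) (Act (snd x))) = (\<Sum>a\<in>(\<lambda>x. Act (snd x)) ` ?A. pmf (\<sigma> (Mec E)) a)"
    by (subst sum.reindex) (auto simp: inj_on_def dest: external_inj)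
  also have "\<dots> = (\<Sum>a\<in>enabled N (Mec E). pmf (\<sigma> (Mec E)) a)"
  proof (rule sum.mono_neutral_left[OF finite_enabled[OF mdp_N]])
    show "(\<lambda>x. Act (snd x)) ` ?A \<subseteq> enabled N (Mec E)"
    proof
      fix a assume "a \<in> (\<lambda>x. Act (snd x)) ` ?A"
      then obtain y where y: "y \<in> ?A" "a = Act (snd y)" by blast
      then have "fst y \<in> fst ` E" "(fst y, snd y) \<in> external M" by (cases y; simp)+
      with y(2) show "a \<in> enabled N (Mec E)" using Act_enabled_external \<iota> by metis
    qed
    show "\<forall>a\<in>enabled N (Mec E) - (\<lambda>x. Act (snd x)) ` ?A. pmf (\<sigma> (Mec E)) a = 0"
    proof
      fix a assume a: "a \<in> enabled N (Mec E) - (\<lambda>x. Act (snd x)) ` ?A"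
      then have "a \<in> enabled N (Mec E)" by simp
      with N(1) show "pmf (\<sigma> (Mec E)) a = 0"
      proof (cases rule: enabled_N_cases)
        case (1 s \<alpha>)
        then have "(s, \<alpha>) \<in> ?A" using quot_map_eq_Mec_iff[OF E] by simp
        then have "a \<in> (\<lambda>x. Act (snd x)) ` ?A" using 1(3) by (intro image_eqI[of _ _ "(s, \<alpha>)"]) simp_all
        then show ?thesis using a by blast
      qed (use tau in simp)
    qed
  qed
  also have "\<dots> = 1" by (rule sum_pmf_enabled[OF mdp_N sched N])
  finally show ?thesis by simp
qed

section \<open>Internal chain and circulation of a component\<close>

definition internal_acts :: "('s \<times> 'a) set \<Rightarrow> 's \<Rightarrow> 'a set" where
  "internal_acts E s = {\<alpha>. (s, \<alpha>) \<in> E}"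

text \<open>The chain that chooses uniformly among the actions of \<open>E\<close>. Giving each of
  them positive weight preserves the graph of \<open>E\<close> and thus irreducibility.\<close>

definition internal_trans :: "('s \<times> 'a) set \<Rightarrow> 's \<Rightarrow> 's \<Rightarrow> real" where
  "internal_trans E s t = (\<Sum>\<alpha>\<in>internal_acts E s. trans M s \<alpha> t) / card (internal_acts E s)"

lemma internal_acts:
  assumes E: "mec M E" and s: "s \<in> fst ` E"
  shows "finite (internal_acts E s)" "internal_acts E s \<noteq> {}" "0 < card (internal_acts E s)"
proof -
  show fin: "finite (internal_acts E s)"
    by (rule finite_subset[OF _ finite_enabled[OF mdp, of s]])
       (use mec_pairD(2)[OF E] in \<open>auto simp: internal_acts_def\<close>)
  show "internal_acts E s \<noteq> {}" using s by (auto simp: internal_acts_def)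
  then show "0 < card (internal_acts E s)" using fin by (simp add: card_gt_0_iff)
qed

lemma trans_mec_0:
  assumes E: "mec M E" "(s, \<alpha>) \<in> E" and t: "t \<in> states M" "t \<notin> fst ` E"
  shows "trans M s \<alpha> t = 0"
  using mec_pairD(3)[OF E t(1)] t trans_nonneg[OF mdp mec_pairD(1,2)[OF E] t(1)] by linarith

text \<open>The internal chain is stochastic because \<open>E\<close> is closed, and irreducible
  because \<open>E\<close> is strongly connected. Inflow and outflow both add up to the frequency of
  the collapsed state.\<close>

lemma mec_circulation:
  assumes E: "mec M E" and tau: "pmf (\<sigma> (Mec E)) Tau = 0"
  obtains x where "\<And>v. v \<in> fst ` E \<Longrightarrow> 0 < x v"
    "\<And>v. v \<in> fst ` E \<Longrightarrow> x v + outflow v = inflow v + (\<Sum>u\<in>fst ` E. x u * internal_trans E u v)"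
proof (rule circulation_exists[of "fst ` E" "internal_trans E" inflow outflow])
  let ?F = "fst ` E"
  note sub = mec_states_subset[OF E]
  have finS: "finite (states M)" using mdp by (simp add: is_mdp_def)
  have nn: "0 \<le> trans M u \<alpha> v" if "\<alpha> \<in> internal_acts E u" "v \<in> ?F" for u v \<alpha>
    using that sub mec_pairD(1,2)[OF E, of u \<alpha>] by (intro trans_nonneg[OF mdp]) (auto simp: internal_acts_def)
  show "finite ?F" using finite_mec[OF E] by simp
  show "?F \<noteq> {}" using E by (auto simp: mec_def end_component_def)
  show "0 \<le> internal_trans E u v" if "v \<in> ?F" for u v
    unfolding internal_trans_def using that nn by (intro divide_nonneg_nonneg sum_nonneg) auto
  show "(\<Sum>v\<in>?F. internal_trans E u v) = 1" if u: "u \<in> ?F" for u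
  proof -
    have "(\<Sum>v\<in>?F. trans M u \<alpha> v) = 1" if \<alpha>: "\<alpha> \<in> internal_acts E u" for \<alpha>
    proof -
      have uE: "(u, \<alpha>) \<in> E" using \<alpha> by (simp add: internal_acts_def)
      have "(\<Sum>v\<in>?F. trans M u \<alpha> v) = (\<Sum>v\<in>states M. trans M u \<alpha> v)"
        using finS sub trans_mec_0[OF E uE] by (intro sum.mono_neutral_left) auto
      also have "\<dots> = 1" using mec_pairD(2)[OF E uE] by (simp add: enabled_def)
      finally show ?thesis .
    qed
    then have "(\<Sum>\<alpha>\<in>internal_acts E u. \<Sum>v\<in>?F. trans M u \<alpha> v) = card (internal_acts E u)"
      by simp
    then have "(\<Sum>v\<in>?F. \<Sum>\<alpha>\<in>internal_acts E u. trans M u \<alpha> v) = card (internal_acts E u)"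
      by (subst sum.swap)
    then show ?thesis
      using internal_acts[OF E u] by (simp add: internal_trans_def flip: sum_divide_distrib)
  qed
  show "(u, v) \<in> {(u, v). u \<in> ?F \<and> v \<in> ?F \<and> 0 < internal_trans E u v}\<^sup>*"
    if uv: "u \<in> ?F" "v \<in> ?F" for u v
  proof -
    have "{(u, v). v \<in> states M \<and> (\<exists>\<alpha>. (u, \<alpha>) \<in> E \<and> trans M u \<alpha> v > 0)}
        \<subseteq> {(u, v). u \<in> ?F \<and> v \<in> ?F \<and> 0 < internal_trans E u v}"
    proof clarify
      fix u v \<alpha> assume v: "v \<in> states M" and uE: "(u, \<alpha>) \<in> E" and pos: "0 < trans M u \<alpha> v"
      have u: "u \<in> ?F" using uE by (simp add: rev_image_eqI)
      have vF: "v \<in> ?F" by (rule mec_pairD(3)[OF E uE v pos])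
      have "trans M u \<alpha> v \<le> (\<Sum>\<alpha>\<in>internal_acts E u. trans M u \<alpha> v)"
        using uE nn vF internal_acts(1)[OF E u]
        by (intro member_le_sum[of \<alpha> _ "\<lambda>\<alpha>. trans M u \<alpha> v"]) (auto simp: internal_acts_def)
      then have "0 < internal_trans E u v"
        unfolding internal_trans_def using pos internal_acts(3)[OF E u] by (intro divide_pos_pos) auto
      with u vF show "u \<in> ?F \<and> v \<in> ?F \<and> 0 < internal_trans E u v" by blast
    qed
    from rtrancl_mono[OF this] mec_connected[OF E uv] show ?thesis by (rule subsetD)
  qed
  show "0 \<le> inflow v" if "v \<in> ?F" for v using that sub inflow_nonneg by blast
  show "sum inflow ?F = sum outflow ?F" by (simp add: sum_inflow_mec[OF E] sum_outflow_mec[OF E tau])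
qed (use that outflow_nonneg in auto)

text \<open>A component of frequency zero has no outflow; following a positive circulation in it,
  the lifted scheduler could never leave, and transience would fail.\<close>

definition live :: "('s \<times> 'a) set \<Rightarrow> bool" where
  "live E \<longleftrightarrow> mec M E \<and> pmf (\<sigma> (Mec E)) Tau = 0 \<and> 0 < freq (Mec E)"

definition active :: "'s set" where
  "active = {s \<in> states M. \<not> terminal M s \<and> (\<forall>E. \<iota> s = Mec E \<longrightarrow> live E)}"

lemma mec_nonterminal:
  assumes "mec M E" "s \<in> fst ` E"
  shows "s \<in> states M" "\<not> terminal M s"
proof -
  obtain \<alpha> where "(s, \<alpha>) \<in> E" using assms(2) by force
  from mec_pairD(1,2)[OF assms(1) this] show "s \<in> states M" "\<not> terminal M s"
    by (auto simp: terminal_def)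
qed

text \<open>Either the component has frequency zero, or \<open>Tau\<close> has probability 1 and
  leaves nothing for the exits. A fractional \<open>Tau\<close> would break this dichotomy.\<close>

lemma flow_not_live:
  assumes E: "mec M E" "\<not> live E" and tau: "pmf (\<sigma> (Mec E)) Tau \<in> {0, 1}" and s: "s \<in> fst ` E"
  shows "flow s \<alpha> = 0"
proof (cases "pmf (\<sigma> (Mec E)) Tau = 0")
  case True
  then have "freq (Mec E) = 0"
    using E freq_nonneg[OF Mec_nonterm[OF E(1)]] by (simp add: live_def)
  then show ?thesis by (simp add: flow_def quot_map_Mec[OF E(1) s])
next
  case False
  then have "pmf (\<sigma> (Mec E)) Tau = 1" using tau by simp
  from pmf_eq_0_if_other_1[OF this, of "Act \<alpha>"]
  show ?thesis by (simp add: flow_def quot_map_Mec[OF E(1) s])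
qed

section \<open>Local choices of the lifted scheduler\<close>

lemma enabled_mec:
  assumes E: "mec M E" and s: "s \<in> fst ` E"
  shows "enabled M s = internal_acts E s \<union> {\<alpha>. (s, \<alpha>) \<in> external M}"
    "internal_acts E s \<inter> {\<alpha>. (s, \<alpha>) \<in> external M} = {}"
proof -
  have "(s, \<alpha>) \<in> external M" if \<alpha>: "\<alpha> \<in> enabled M s" "(s, \<alpha>) \<notin> E" for \<alpha>
  proof -
    have "(s, \<alpha>) \<in> exits M E" using \<alpha> s by (simp add: exits_def)
    then show ?thesis by (simp add: exits_iff[OF E])
  qed
  then show "enabled M s = internal_acts E s \<union> {\<alpha>. (s, \<alpha>) \<in> external M}"
    using mec_pairD(2)[OF E] by (auto simp: internal_acts_def external_def)
  show "internal_acts E s \<inter> {\<alpha>. (s, \<alpha>) \<in> external M} = {}"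
    using E by (auto simp: internal_acts_def external_def)
qed

text \<open>The weight of \<open>s\<close> is the frequency that \<open>s\<close> will have: inside a live component the
  circulation is spread evenly over the internal actions, on top of the prescribed exit flow.\<close>

lemma local_choice_live:
  assumes E: "mec M E" and s: "s \<in> fst ` E" and c: "0 < c"
  obtains p where "set_pmf p \<subseteq> enabled M s"
    "\<And>\<alpha>. (s, \<alpha>) \<in> external M \<Longrightarrow> (c + outflow s) * pmf p \<alpha> = flow s \<alpha>"
    "\<And>\<alpha>. (s, \<alpha>) \<in> E \<Longrightarrow> (c + outflow s) * pmf p \<alpha> = c / card (internal_acts E s)"
proof -
  let ?I = "internal_acts E s" and ?X = "{\<alpha>. (s, \<alpha>) \<in> external M}"
  define w where "w \<alpha> = (if (s, \<alpha>) \<in> E then c / card ?I else flow s \<alpha>) / (c + outflow s)" for \<alpha>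
  have tot: "0 < c + outflow s" using c outflow_nonneg[of s] by linarith
  note en = enabled_mec[OF E s] and I = internal_acts[OF E s]
  have notE: "(s, \<alpha>) \<notin> E" if "\<alpha> \<in> ?X" for \<alpha> using en(2) that by (auto simp: internal_acts_def)
  have sumI: "(\<Sum>\<alpha>\<in>?I. w \<alpha>) = c / (c + outflow s)"
  proof -
    have "(\<Sum>\<alpha>\<in>?I. w \<alpha>) = (\<Sum>\<alpha>\<in>?I. c / card ?I / (c + outflow s))"
      by (intro sum.cong refl) (simp add: w_def internal_acts_def)
    then show ?thesis using I(1,2) by simp
  qed
  have sumX: "(\<Sum>\<alpha>\<in>?X. w \<alpha>) = outflow s / (c + outflow s)"
  proof -
    have "(\<Sum>\<alpha>\<in>?X. w \<alpha>) = (\<Sum>\<alpha>\<in>?X. flow s \<alpha> / (c + outflow s))"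
      by (intro sum.cong refl) (use notE in \<open>simp add: w_def\<close>)
    then show ?thesis by (simp add: outflow_def sum_divide_distrib)
  qed
  have "sum w (enabled M s) = sum w ?I + sum w ?X"
    unfolding en(1) by (rule sum.union_disjoint) (use I(1) finite_external_at en(2) in auto)
  also have "\<dots> = 1" unfolding sumI sumX using tot by (simp flip: add_divide_distrib)
  finally have one: "sum w (enabled M s) = 1" .
  have "0 \<le> w \<alpha>" if "\<alpha> \<in> enabled M s" for \<alpha>
  proof (cases "(s, \<alpha>) \<in> E")
    case False
    then have "(s, \<alpha>) \<in> external M" using that en(1) by (auto simp: internal_acts_def)
    then show ?thesis using False tot flow_nonneg by (simp add: w_def)
  qed (use c tot in \<open>simp add: w_def\<close>)
  from pmf_of_weights[OF finite_enabled[OF mdp] this one]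
  obtain p where p: "set_pmf p \<subseteq> enabled M s" "\<And>\<alpha>. \<alpha> \<in> enabled M s \<Longrightarrow> pmf p \<alpha> = w \<alpha>" by blast
  show thesis
  proof (rule that[OF p(1)])
    show "(c + outflow s) * pmf p \<alpha> = flow s \<alpha>" if \<alpha>: "(s, \<alpha>) \<in> external M" for \<alpha>
    proof -
      have "pmf p \<alpha> = w \<alpha>" using \<alpha> by (intro p(2)) (simp add: external_def)
      then show ?thesis using tot notE \<alpha> by (simp add: w_def)
    qed
    show "(c + outflow s) * pmf p \<alpha> = c / card ?I" if \<alpha>: "(s, \<alpha>) \<in> E" for \<alpha>
    proof -
      have "pmf p \<alpha> = w \<alpha>" by (intro p(2) mec_pairD(2)[OF E \<alpha>])
      then show ?thesis using tot \<alpha> by (simp add: w_def)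
    qed
  qed
qed

lemma local_choice_non_mec:
  assumes s: "s \<in> states M" "\<not> terminal M s" "s \<notin> mec_states M"
  obtains p where "set_pmf p \<subseteq> enabled M s"
    "\<And>\<alpha>. \<alpha> \<in> enabled M s \<Longrightarrow> pmf p \<alpha> = pmf (\<sigma> (Orig s)) (Act \<alpha>)"
proof -
  have \<iota>: "\<iota> s = Orig s" using s(3) by (simp add: quot_map_eq_Orig_iff)
  have N: "Orig s \<in> states N" "\<not> terminal N (Orig s)"
    using nonterm_quot_map[OF s(1,2)] by (simp_all add: \<iota> nonterm_def)
  have "enabled N (Orig s) = Act ` enabled M s"
  proof
    show "Act ` enabled M s \<subseteq> enabled N (Orig s)"
      using Act_enabled_external[of s] s by (auto simp: external_non_mec \<iota>)
    show "enabled N (Orig s) \<subseteq> Act ` enabled M s"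
    proof
      fix a assume "a \<in> enabled N (Orig s)"
      with N(1) show "a \<in> Act ` enabled M s"
        by (cases rule: enabled_N_cases) (auto simp: quot_map_eq_Orig_iff external_def)
    qed
  qed
  then have "(\<Sum>\<alpha>\<in>enabled M s. pmf (\<sigma> (Orig s)) (Act \<alpha>)) = 1"
    using sum_pmf_enabled[OF mdp_N sched N] by (simp add: sum.reindex inj_on_def)
  from pmf_of_weights[OF finite_enabled[OF mdp] pmf_nonneg this] show thesis
    using that by metis
qed

end

section \<open>The lifted scheduler\<close>

text \<open>\<open>x\<close> is the vector of state frequencies, \<open>c E\<close> the part of it due to actions of \<open>E\<close>.\<close>

locale lifted_scheduler = quotient_scheduler M \<sigma>
  for M :: "('s, 'a) mdp" and \<sigma> :: "('s, 'a) qstate \<Rightarrow> 'a qact pmf" +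
  fixes T :: "'s \<Rightarrow> 'a pmf" and x :: "'s \<Rightarrow> real" and c :: "('s \<times> 'a) set \<Rightarrow> 's \<Rightarrow> real"
  assumes tau: "\<And>E. mec M E \<Longrightarrow> pmf (\<sigma> (Mec E)) Tau \<in> {0, 1}"
    and lifted: "mr_scheduler M T"
    and x_non_mec: "\<And>s. s \<notin> mec_states M \<Longrightarrow> x s = freq (\<iota> s)"
    and T_non_mec: "\<And>s \<alpha>. s \<notin> mec_states M \<Longrightarrow> (s, \<alpha>) \<in> external M \<Longrightarrow>
      pmf (T s) \<alpha> = pmf (\<sigma> (\<iota> s)) (Act \<alpha>)"
    and x_live: "\<And>E s. live E \<Longrightarrow> s \<in> fst ` E \<Longrightarrow> x s = c E s + outflow s"
    and c_pos: "\<And>E s. live E \<Longrightarrow> s \<in> fst ` E \<Longrightarrow> 0 < c E s"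
    and circulation: "\<And>E s. live E \<Longrightarrow> s \<in> fst ` E \<Longrightarrow>
      c E s + outflow s = inflow s + (\<Sum>u\<in>fst ` E. c E u * internal_trans E u s)"
    and T_exit: "\<And>E s \<alpha>. live E \<Longrightarrow> s \<in> fst ` E \<Longrightarrow> (s, \<alpha>) \<in> external M \<Longrightarrow>
      x s * pmf (T s) \<alpha> = flow s \<alpha>"
    and T_internal: "\<And>E s \<alpha>. live E \<Longrightarrow> (s, \<alpha>) \<in> E \<Longrightarrow>
      x s * pmf (T s) \<alpha> = c E s / card (internal_acts E s)"
    and T_not_live: "\<And>E s \<alpha>. mec M E \<Longrightarrow> \<not> live E \<Longrightarrow> s \<in> fst ` E \<Longrightarrow> (s, \<alpha>) \<notin> E \<Longrightarrow>
      pmf (T s) \<alpha> = 0"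

context quotient_scheduler
begin

lemma lifted_scheduler_exists:
  assumes tau: "\<And>E. mec M E \<Longrightarrow> pmf (\<sigma> (Mec E)) Tau \<in> {0, 1}"
  obtains T x c where "lifted_scheduler M \<sigma> T x c"
proof -
  have "\<exists>y. live E \<longrightarrow> (\<forall>v\<in>fst ` E. 0 < y v \<and>
      y v + outflow v = inflow v + (\<Sum>u\<in>fst ` E. y u * internal_trans E u v))" for E
  proof (cases "live E")
    case True
    then have "mec M E" "pmf (\<sigma> (Mec E)) Tau = 0" by (auto simp: live_def)
    then show ?thesis by (rule mec_circulation) blast
  qed simp
  then obtain c where c: "\<And>E. live E \<Longrightarrow> \<forall>v\<in>fst ` E. 0 < c E v \<and>
      c E v + outflow v = inflow v + (\<Sum>u\<in>fst ` E. c E u * internal_trans E u v)"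
    by metis
  \<comment> \<open>At each state only one of the three clauses is not vacuous; stating them
    together lets a single application of choice produce the scheduler.\<close>
  have "\<exists>p. set_pmf p \<subseteq> enabled M s \<and>
      (s \<notin> mec_states M \<longrightarrow> (\<forall>\<alpha>\<in>enabled M s. pmf p \<alpha> = pmf (\<sigma> (Orig s)) (Act \<alpha>))) \<and>
      (\<forall>E. live E \<and> s \<in> fst ` E \<longrightarrow>
         (\<forall>\<alpha>. (s, \<alpha>) \<in> external M \<longrightarrow> (c E s + outflow s) * pmf p \<alpha> = flow s \<alpha>) \<and>
         (\<forall>\<alpha>. (s, \<alpha>) \<in> E \<longrightarrow> (c E s + outflow s) * pmf p \<alpha> = c E s / card (internal_acts E s))) \<and>
      (\<forall>E. mec M E \<and> \<not> live E \<and> s \<in> fst ` E \<longrightarrow> (\<forall>\<alpha>. (s, \<alpha>) \<notin> E \<longrightarrow> pmf p \<alpha> = 0))"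
    (is "\<exists>p. ?ok s p") if s: "s \<in> states M" "\<not> terminal M s" for s
  proof (cases rule: quot_map_cases[of s M])
    case 1
    have no: "s \<notin> fst ` E" if "mec M E" for E using 1 that by (auto simp: mec_states_def)
    obtain p where "set_pmf p \<subseteq> enabled M s"
      "\<And>\<alpha>. \<alpha> \<in> enabled M s \<Longrightarrow> pmf p \<alpha> = pmf (\<sigma> (Orig s)) (Act \<alpha>)"
      using local_choice_non_mec[OF s 1(1)] by blast
    moreover have "s \<notin> fst ` E" if "live E" for E using that no by (simp add: live_def)
    ultimately have "?ok s p" using no by blast
    then show ?thesis ..
  next
    case (2 E)
    have uniq: "F = E" if "mec M F" "s \<in> fst ` F" for F
      by (rule mec_unique[OF that(1) 2(1) that(2) 2(2)])
    have mecs: "s \<in> mec_states M" using 2 by (auto simp: mec_states_def)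
    show ?thesis
    proof (cases "live E")
      case True
      then have pos: "0 < c E s" using c 2(2) by blast
      obtain p where p: "set_pmf p \<subseteq> enabled M s"
        "\<And>\<alpha>. (s, \<alpha>) \<in> external M \<Longrightarrow> (c E s + outflow s) * pmf p \<alpha> = flow s \<alpha>"
        "\<And>\<alpha>. (s, \<alpha>) \<in> E \<Longrightarrow> (c E s + outflow s) * pmf p \<alpha> = c E s / card (internal_acts E s)"
        by (rule local_choice_live[OF 2(1,2) pos]) blast
      have "?ok s p"
      proof (intro conjI allI impI)
        show "set_pmf p \<subseteq> enabled M s" by (rule p(1))
        fix F assume "live F \<and> s \<in> fst ` F"
        then have "F = E" using uniq by (simp add: live_def)
        then show "(c F s + outflow s) * pmf p \<alpha> = flow s \<alpha>" if "(s, \<alpha>) \<in> external M" for \<alpha>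
          using p(2) that by simp
        show "(c F s + outflow s) * pmf p \<alpha> = c F s / card (internal_acts F s)" if "(s, \<alpha>) \<in> F" for \<alpha>
          using p(3) that \<open>F = E\<close> by simp
      next
        fix F \<alpha> assume "mec M F \<and> \<not> live F \<and> s \<in> fst ` F"
        then show "pmf p \<alpha> = 0" using uniq[of F] True by simp
      qed (use mecs in simp)
      then show ?thesis ..
    next
      case False
      \<comment> \<open>Any distribution on the internal actions would do; its only purpose is never
        to leave \<open>E\<close>.\<close>
      let ?p = "pmf_of_set (internal_acts E s)"
      note I = internal_acts[OF 2(1,2)]
      have set: "set_pmf ?p = internal_acts E s" using I by simp
      have "?ok s ?p"
      proof (intro conjI allI impI)
        show "set_pmf ?p \<subseteq> enabled M s" unfolding set using enabled_mec(1)[OF 2(1,2)] by simp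
        fix F assume "live F \<and> s \<in> fst ` F"
        then have False using uniq[of F] False by (simp add: live_def)
        then show "(c F s + outflow s) * pmf ?p \<alpha> = flow s \<alpha>"
          "(c F s + outflow s) * pmf ?p \<alpha> = c F s / card (internal_acts F s)" for \<alpha> by blast+
      next
        fix F \<alpha> assume F: "mec M F \<and> \<not> live F \<and> s \<in> fst ` F" "(s, \<alpha>) \<notin> F"
        then have "\<alpha> \<notin> set_pmf ?p" unfolding set using uniq[of F] by (simp add: internal_acts_def)
        then show "pmf ?p \<alpha> = 0" by (simp add: set_pmf_iff)
      qed (use mecs in simp)
      then show ?thesis ..
    qed
  qed
  then have "\<forall>s\<in>{s \<in> states M. \<not> terminal M s}. \<exists>p. ?ok s p" by blast
  from bchoice[OF this] obtain T where T0: "\<forall>s\<in>{s \<in> states M. \<not> terminal M s}. ?ok s (T s)" ..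
  have T: "?ok s (T s)" if "s \<in> states M" "\<not> terminal M s" for s
    by (rule bspec[OF T0]) (use that in simp)
  note T1 = T[THEN conjunct1] and T2 = T[THEN conjunct2, THEN conjunct1, rule_format]
    and T3 = T[THEN conjunct2, THEN conjunct2, THEN conjunct1, rule_format]
    and T4 = T[THEN conjunct2, THEN conjunct2, THEN conjunct2, rule_format]
  \<comment> \<open>In components that are not live, \<open>c\<close> is unspecified and the value
    of \<open>x\<close> is arbitrary; such states are not \<open>active\<close>.\<close>
  define x where "x s = (case \<iota> s of Mec E \<Rightarrow> c E s + outflow s | _ \<Rightarrow> freq (\<iota> s))" for s
  have x_live: "x s = c E s + outflow s" if "live E" "s \<in> fst ` E" for E s
    using that quot_map_Mec[of M E s] by (simp add: x_def live_def)
  show thesis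
  proof (rule that[of T x c], unfold_locales)
    show "pmf (\<sigma> (Mec E)) Tau \<in> {0, 1}" if "mec M E" for E by (rule assms[OF that])
    show "mr_scheduler M T" using T1 by (simp add: mr_scheduler_def)
    show "x s = freq (\<iota> s)" if "s \<notin> mec_states M" for s
      using that by (simp add: x_def quot_map_def)
    show "pmf (T s) \<alpha> = pmf (\<sigma> (\<iota> s)) (Act \<alpha>)" if "s \<notin> mec_states M" "(s, \<alpha>) \<in> external M" for s \<alpha>
    proof -
      have "s \<in> states M" "\<alpha> \<in> enabled M s" "\<not> terminal M s" using that by (auto simp: external_def terminal_def)
      then show ?thesis using T2[of s \<alpha>] that(1) by (simp add: quot_map_def)
    qed
    show "x s = c E s + outflow s" if "live E" "s \<in> fst ` E" for E s by (rule x_live[OF that])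
    show "0 < c E s" "c E s + outflow s = inflow s + (\<Sum>u\<in>fst ` E. c E u * internal_trans E u s)"
      if "live E" "s \<in> fst ` E" for E s using c[OF that(1)] that(2) by blast+
    show "x s * pmf (T s) \<alpha> = flow s \<alpha>" if "live E" "s \<in> fst ` E" "(s, \<alpha>) \<in> external M" for E s \<alpha>
    proof -
      have "mec M E" using that(1) by (simp add: live_def)
      from T3[OF mec_nonterminal[OF this that(2)] conjI[OF that(1,2)], THEN conjunct1] show ?thesis
        unfolding x_live[OF that(1,2)] using that by simp
    qed
    show "x s * pmf (T s) \<alpha> = c E s / card (internal_acts E s)" if "live E" "(s, \<alpha>) \<in> E" for E s \<alpha>
    proof -
      have s: "s \<in> fst ` E" using that(2) by (simp add: rev_image_eqI)
      have "mec M E" using that(1) by (simp add: live_def)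
      from T3[OF mec_nonterminal[OF this s] conjI[OF that(1) s], THEN conjunct2] show ?thesis
        unfolding x_live[OF that(1) s] using that s by simp
    qed
    show "pmf (T s) \<alpha> = 0" if "mec M E" "\<not> live E" "s \<in> fst ` E" "(s, \<alpha>) \<notin> E" for E s \<alpha>
      by (rule T4[OF mec_nonterminal[OF that(1,3)]]) (use that in simp_all)
  qed
qed

end

section \<open>Flow equations of the lifted scheduler\<close>

context lifted_scheduler
begin

lemma active_cases:
  assumes "s \<in> active"
  obtains "s \<notin> mec_states M" "\<iota> s = Orig s"
    | E where "live E" "mec M E" "s \<in> fst ` E" "\<iota> s = Mec E"
proof (cases rule: quot_map_cases[of s M])
  case (2 E)
  then have "live E" using assms by (simp add: active_def)
  then show thesis by (rule that(2)[OF _ 2])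
qed (rule that(1))

lemma inactive_cases:
  assumes "s \<in> states M" "s \<notin> active" "\<not> terminal M s"
  obtains E where "mec M E" "\<not> live E" "s \<in> fst ` E"
proof (cases rule: quot_map_cases[of s M])
  case 1
  then show thesis using assms by (simp add: active_def)
next
  case (2 E)
  then show thesis using assms that by (simp add: active_def)
qed

lemma inactive_external:
  assumes ext: "(s, \<alpha>) \<in> external M" and s: "s \<notin> active"
  shows "flow s \<alpha> = 0" "pmf (T s) \<alpha> = 0"
proof -
  have "s \<in> states M" "\<not> terminal M s" using ext by (auto simp: external_def terminal_def)
  then obtain E where E: "mec M E" "\<not> live E" "s \<in> fst ` E" using s inactive_cases by blast
  show "flow s \<alpha> = 0" by (rule flow_not_live[OF E(1,2) tau[OF E(1)] E(3)])
  have "(s, \<alpha>) \<notin> E" using ext E(1) by (simp add: external_def)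
  then show "pmf (T s) \<alpha> = 0" by (rule T_not_live[OF E])
qed

lemma active_external:
  assumes s: "s \<in> active" and ext: "(s, \<alpha>) \<in> external M"
  shows "x s * pmf (T s) \<alpha> = flow s \<alpha>"
  using s
proof (cases rule: active_cases)
  case 1
  then show ?thesis using x_non_mec T_non_mec[OF 1(1) ext] by (simp add: flow_def)
next
  case (2 E)
  show ?thesis by (rule T_exit[OF 2(1,3) ext])
qed

lemma finite_active: "finite active"
  using mdp by (simp add: active_def is_mdp_def)

lemma internal_pairs: "E = Sigma (fst ` E) (internal_acts E)"
  by (auto simp: internal_acts_def image_iff) force

text \<open>External pairs contribute, together with the initial mass, exactly the inflow of
  \<open>t\<close>. Internal pairs reach \<open>t\<close> only within its own component, where
  \<open>circulation\<close> supplies the rest; outside all components the fibre is a single state,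
  whose inflow is its frequency.\<close>

lemma flow_balance:
  assumes t: "t \<in> active"
  shows "x t = occupation M T 0 t + (\<Sum>s\<in>active. x s * trans_under M T s t)"
proof -
  let ?D = "Sigma active (enabled M)" and ?h = "\<lambda>(s, \<alpha>). x s * pmf (T s) \<alpha> * trans M s \<alpha> t"
  have tM: "t \<in> states M" using t by (simp add: active_def)
  have finD: "finite ?D" using finite_active finite_enabled[OF mdp] by (rule finite_SigmaI)
  have "(\<Sum>s\<in>active. x s * trans_under M T s t) = (\<Sum>s\<in>active. \<Sum>\<alpha>\<in>enabled M s. ?h (s, \<alpha>))"
    by (intro sum.cong refl) (simp add: trans_under_def active_def sum_distrib_left mult.assoc)
  also have "\<dots> = sum ?h ?D"
    by (subst sum.Sigma) (simp_all add: finite_active finite_enabled[OF mdp])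
  also have "\<dots> = sum ?h (?D \<inter> external M) + sum ?h (?D - external M)"
    by (rule sum.Int_Diff[OF finD])
  also have "sum ?h (?D \<inter> external M) = (\<Sum>(s, \<alpha>)\<in>?D \<inter> external M. flow s \<alpha> * trans M s \<alpha> t)"
    by (intro sum.cong refl) (auto simp: active_external)
  \<comment> \<open>External pairs at inactive states carry no flow, so the sum extends to all
    external pairs.\<close>
  also have "\<dots> = (\<Sum>(s, \<alpha>)\<in>external M. flow s \<alpha> * trans M s \<alpha> t)"
  proof (rule sum.mono_neutral_left[OF finite_external[OF mdp]])
    show "\<forall>y\<in>external M - ?D \<inter> external M. (case y of (s, \<alpha>) \<Rightarrow> flow s \<alpha> * trans M s \<alpha> t) = 0"
    proof
      fix y assume y: "y \<in> external M - ?D \<inter> external M"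
      obtain s \<alpha> where sa: "y = (s, \<alpha>)" by (cases y)
      then have ext: "(s, \<alpha>) \<in> external M" and "s \<notin> active" using y by (auto simp: external_def)
      from inactive_external(1)[OF this] show "(case y of (s, \<alpha>) \<Rightarrow> flow s \<alpha> * trans M s \<alpha> t) = 0"
        by (simp add: sa)
    qed
  qed simp
  finally have sum: "occupation M T 0 t + (\<Sum>s\<in>active. x s * trans_under M T s t) =
      inflow t + sum ?h (?D - external M)"
    by (simp add: inflow_def)
  have internal: "\<exists>E. mec M E \<and> (s, \<alpha>) \<in> E" if "(s, \<alpha>) \<in> ?D - external M" for s \<alpha>
    using that by (auto simp: external_def active_def)
  have zero: "?h (s, \<alpha>) = 0" if "mec M E" "(s, \<alpha>) \<in> E" "t \<notin> fst ` E" for s \<alpha> E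
    using trans_mec_0[OF that(1,2) tM that(3)] by simp
  show ?thesis
    using t
  proof (cases rule: active_cases)
    case 1
    have no: "t \<notin> fst ` E" if "mec M E" for E using 1 that by (auto simp: mec_states_def)
    have "sum ?h (?D - external M) = 0"
    proof (rule sum.neutral, rule ballI)
      fix y assume y: "y \<in> ?D - external M"
      obtain s \<alpha> where sa: "y = (s, \<alpha>)" by (cases y)
      then obtain E where E: "mec M E" "(s, \<alpha>) \<in> E" using internal[of s \<alpha>] y by blast
      show "?h y = 0" unfolding sa by (rule zero[OF E no[OF E(1)]])
    qed
    moreover have "inflow t = freq (\<iota> t)"
    proof -
      have "u = t" if "\<iota> u = \<iota> t" for u
        using that 1(2) quot_map_eq_Orig_iff[of M u t] by simp
      then have "{u \<in> states M. \<iota> u = \<iota> t} = {t}" using tM by blast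
      moreover have "\<iota> t \<in> nonterm" using t by (intro nonterm_quot_map) (auto simp: active_def)
      ultimately show ?thesis using sum_inflow[of "\<iota> t"] by simp
    qed
    ultimately show ?thesis using sum x_non_mec[OF 1(1)] by simp
  next
    case (2 E)
    have "E \<subseteq> ?D - external M"
    proof (rule subrelI)
      fix s \<alpha> assume E: "(s, \<alpha>) \<in> E"
      then have s: "s \<in> fst ` E" by (simp add: rev_image_eqI)
      then have "\<iota> s = Mec E" using quot_map_Mec[OF 2(2)] by blast
      then have "s \<in> active" using mec_nonterminal[OF 2(2) s] 2(1) by (simp add: active_def)
      then show "(s, \<alpha>) \<in> ?D - external M"
        using mec_pairD(2)[OF 2(2) E] E 2(2) by (auto simp: external_def)
    qed
    then have "sum ?h (?D - external M) = sum ?h E"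
    proof (intro sum.mono_neutral_right)
      show "finite (?D - external M)" using finD by simp
      show "\<forall>y\<in>?D - external M - E. ?h y = 0"
      proof
        fix y assume y: "y \<in> ?D - external M - E"
        obtain s \<alpha> where sa: "y = (s, \<alpha>)" by (cases y)
        then obtain F where F: "mec M F" "(s, \<alpha>) \<in> F" using internal[of s \<alpha>] y by blast
        have "t \<notin> fst ` F"
        proof
          assume "t \<in> fst ` F"
          then have "F = E" by (rule mec_unique[OF F(1) 2(2) _ 2(3)])
          then show False using y F(2) sa by simp
        qed
        then show "?h y = 0" unfolding sa by (rule zero[OF F])
      qed
    qed
    also have "\<dots> = (\<Sum>s\<in>fst ` E. \<Sum>\<alpha>\<in>internal_acts E s. ?h (s, \<alpha>))"
      using finite_mec[OF 2(2)] internal_acts(1)[OF 2(2)]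
      by (subst sum.Sigma) (simp_all flip: internal_pairs)
    also have "\<dots> = (\<Sum>s\<in>fst ` E. c E s * internal_trans E s t)"
    proof (intro sum.cong refl)
      fix s assume "s \<in> fst ` E"
      have "(\<Sum>\<alpha>\<in>internal_acts E s. ?h (s, \<alpha>)) =
          (\<Sum>\<alpha>\<in>internal_acts E s. c E s / card (internal_acts E s) * trans M s \<alpha> t)"
        by (intro sum.cong refl) (simp add: T_internal[OF 2(1)] internal_acts_def)
      then show "(\<Sum>\<alpha>\<in>internal_acts E s. ?h (s, \<alpha>)) = c E s * internal_trans E s t"
        by (simp add: internal_trans_def sum_distrib_left sum_divide_distrib)
    qed
    finally show ?thesis using sum x_live[OF 2(1,3)] circulation[OF 2(1,3)] by simp
  qed
qed

section \<open>Transience of the lifted scheduler on the active states\<close>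

lemma T_step:
  assumes s: "s \<in> active" and \<alpha>: "\<alpha> \<in> enabled M s" "0 < pmf (T s) \<alpha>"
    and t: "t \<in> states M" "0 < trans M s \<alpha> t"
  shows "(s, t) \<in> {(u, v). u \<in> active \<and> v \<in> states M \<and> 0 < trans_under M T u v}"
proof -
  have "s \<in> states M" using s by (simp add: active_def)
  then have "0 < trans_under M T s t" using trans_under_pos_iff[OF mdp _ t(1)] \<alpha> t(2) by blast
  then show ?thesis using s t(1) by simp
qed

text \<open>In a live component, positive frequency turns a positive choice in the quotient into
  positive flow, hence into a positive choice in \<open>M\<close>.\<close>

lemma T_external_pos:
  assumes s: "s \<in> active" and ext: "(s, \<alpha>) \<in> external M" and pos: "0 < pmf (\<sigma> (\<iota> s)) (Act \<alpha>)"
  shows "0 < pmf (T s) \<alpha>"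
  using s
proof (cases rule: active_cases)
  case 1
  then show ?thesis using T_non_mec[OF 1(1) ext] pos by simp
next
  case (2 E)
  then have "0 < flow s \<alpha>" using pos by (simp add: flow_def live_def)
  then have "pmf (T s) \<alpha> \<noteq> 0" using active_external[OF s ext] by auto
  then show ?thesis by (simp add: pmf_pos)
qed

text \<open>Strict positivity of the circulation pays off here: the component stays strongly
  connected under \<open>T\<close>, so each exit can be reached from each entry state.\<close>

lemma T_internal_pos:
  assumes E: "live E" "(s, \<alpha>) \<in> E"
  shows "0 < pmf (T s) \<alpha>"
proof -
  have s: "s \<in> fst ` E" using E(2) by (simp add: rev_image_eqI)
  have "mec M E" using E(1) by (simp add: live_def)
  then have "0 < c E s / card (internal_acts E s)"
    using c_pos[OF E(1) s] internal_acts(3)[OF _ s] by simp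
  then have "pmf (T s) \<alpha> \<noteq> 0" using T_internal[OF E] by auto
  then show ?thesis by (simp add: pmf_pos)
qed

text \<open>A path to a terminal state of the quotient is lifted edge by edge until it meets an
  inactive state. The start ranges over the whole fibre because the entry state of a component is
  arbitrary.\<close>

lemma leaves_active:
  assumes q: "(q, q') \<in> edges\<^sup>*" and q': "terminal N q'" and s: "s \<in> states M" "\<iota> s = q"
  shows "\<exists>t\<in>states M - active.
    (s, t) \<in> {(u, v). u \<in> active \<and> v \<in> states M \<and> 0 < trans_under M T u v}\<^sup>*"
  using q s
proof (induction arbitrary: s rule: converse_rtrancl_induct)
  case base
  then have "terminal M s" using q' terminal_quot_map_iff[of s] by simp
  then have "s \<notin> active" by (simp add: active_def)
  then show ?case using base(1) by blast
next
  case (step p p')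
  let ?R = "{(u, v). u \<in> active \<and> v \<in> states M \<and> 0 < trans_under M T u v}"
  show ?case
  proof (cases "s \<in> active")
    case True
    have p: "p \<in> states N" "p' \<in> states N" "0 < trans_under N \<sigma> p p'"
      using step.hyps(1) by (auto simp: edges_def)
    have "\<exists>u \<alpha> t. (u, \<alpha>) \<in> external M \<and> \<iota> u = p \<and> 0 < pmf (\<sigma> p) (Act \<alpha>) \<and>
        t \<in> states M \<and> \<iota> t = p' \<and> 0 < trans M u \<alpha> t"
    proof (cases "p' = Bot")
      case False
      show ?thesis by (rule quot_step[OF p(1,2) False p(3)]) blast
    next
      case True
      obtain a where a: "a \<in> enabled N p" "0 < pmf (\<sigma> p) a" "0 < trans N p a p'"
        using p(3) trans_under_pos_iff[OF mdp_N p(1,2)] by blast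
      \<comment> \<open>Only \<open>Tau\<close> enters \<open>Bot\<close>, and live components give
        it probability 0.\<close>
      from p(1) a(1) have False
      proof (cases rule: enabled_N_cases)
        case (1 u \<alpha>)
        have "trans_quot M u \<alpha> Bot = 0" by (simp add: trans_quot_def quot_map_neq_Bot)
        then show False using trans_N_external[OF 1(1)] a(3) 1(2,3) True by simp
      next
        case (2 E)
        then have "live E" using \<open>s \<in> active\<close> step.prems by (simp add: active_def)
        then show False using a(2) 2 by (simp add: live_def)
      qed
      then show ?thesis ..
    qed
    then obtain u \<alpha> t where u: "(u, \<alpha>) \<in> external M" "\<iota> u = p" "0 < pmf (\<sigma> p) (Act \<alpha>)"
      "t \<in> states M" "\<iota> t = p'" "0 < trans M u \<alpha> t" by blast
    have uM: "u \<in> states M" "\<alpha> \<in> enabled M u" "\<not> terminal M u"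
      using u(1) by (auto simp: external_def terminal_def)
    have "\<forall>E. \<iota> s = Mec E \<longrightarrow> live E" using True by (simp add: active_def)
    then have u_act: "u \<in> active" using uM u(2) step.prems(2) by (simp add: active_def)
    \<comment> \<open>Before the exit can be taken, the walk must reach its owner \<open>u\<close>
      inside the component.\<close>
    have su: "(s, u) \<in> ?R\<^sup>*"
      using True
    proof (cases rule: active_cases)
      case 1
      then have "\<iota> u = Orig s" using u(2) step.prems(2) by simp
      then show ?thesis by (simp add: quot_map_eq_Orig_iff)
    next
      case (2 E)
      have "\<iota> u = Mec E" using 2(4) u(2) step.prems(2) by simp
      then have uE: "u \<in> fst ` E" using quot_map_eq_Mec_iff[OF 2(2)] by simp
      have "{(u, v). v \<in> states M \<and> (\<exists>\<alpha>. (u, \<alpha>) \<in> E \<and> trans M u \<alpha> v > 0)} \<subseteq> ?R"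
      proof (rule subrelI)
        fix y z assume "(y, z) \<in> {(u, v). v \<in> states M \<and> (\<exists>\<alpha>. (u, \<alpha>) \<in> E \<and> trans M u \<alpha> v > 0)}"
        then obtain \<beta> where z: "z \<in> states M" "(y, \<beta>) \<in> E" "0 < trans M y \<beta> z" by blast
        have y: "y \<in> fst ` E" using z(2) by (simp add: rev_image_eqI)
        have "y \<in> active" using mec_nonterminal[OF 2(2) y] quot_map_Mec[OF 2(2) y] 2(1)
          by (simp add: active_def)
        then show "(y, z) \<in> ?R"
          by (rule T_step[OF _ mec_pairD(2)[OF 2(2) z(2)] T_internal_pos[OF 2(1) z(2)] z(1,3)])
      qed
      from rtrancl_mono[OF this] mec_connected[OF 2(2,3) uE] show ?thesis by (rule subsetD)
    qed
    have "0 < pmf (T u) \<alpha>" using T_external_pos[OF u_act u(1)] u(2,3) by simp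
    then have ut: "(u, t) \<in> ?R" by (rule T_step[OF u_act uM(2) _ u(4,6)])
    obtain t' where t': "t' \<in> states M - active" "(t, t') \<in> ?R\<^sup>*"
      using step.IH[OF u(4,5)] ..
    have "(s, t') \<in> ?R\<^sup>*"
      by (rule rtrancl_trans[OF su converse_rtrancl_into_rtrancl[OF ut t'(2)]])
    then show ?thesis using t'(1) by blast
  qed (use step.prems in blast)
qed

lemma transient_T: "transient active (trans_under M T)"
proof (rule transientI)
  show "finite (states M)" using mdp by (simp add: is_mdp_def)
  show "active \<subseteq> states M" by (auto simp: active_def)
  show "0 \<le> trans_under M T s t" if "s \<in> active" "t \<in> states M" for s t
    using that by (intro trans_under_nonneg[OF mdp]) (simp_all add: active_def)
  show "(\<Sum>t\<in>states M. trans_under M T s t) \<le> 1" if "s \<in> active" for s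
    using that sum_trans_under[OF mdp lifted] by (simp add: active_def)
  show "\<exists>t\<in>states M - active.
      (s, t) \<in> {(u, v). u \<in> active \<and> v \<in> states M \<and> 0 < trans_under M T u v}\<^sup>*" if "s \<in> active" for s
  proof -
    have s: "s \<in> states M" using that by (simp add: active_def)
    obtain q where "terminal N q" "(\<iota> s, q) \<in> edges\<^sup>*"
      using terminal_reachable[OF quot_map_in_states[OF s]] by blast
    from leaves_active[OF this(2,1) s refl] show ?thesis .
  qed
qed

text \<open>\<open>T\<close> never leaves a component that is not live, and terminal rows are zero.
  Hence the occupation recursion closes on \<open>active\<close>, even where inactive states are
  visited infinitely often.\<close>

lemma inactive_closed:
  assumes s: "s \<in> states M" "s \<notin> active" and t: "t \<in> active"
  shows "trans_under M T s t = 0"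
proof (cases "terminal M s")
  case False
  obtain E where E: "mec M E" "\<not> live E" "s \<in> fst ` E" using inactive_cases[OF s False] .
  have tM: "t \<in> states M" using t by (simp add: active_def)
  have "t \<notin> fst ` E" using t E(2) quot_map_Mec[OF E(1)] by (auto simp: active_def)
  then have "trans M s \<alpha> t = 0" if "(s, \<alpha>) \<in> E" for \<alpha> by (rule trans_mec_0[OF E(1) that tM])
  then have "pmf (T s) \<alpha> * trans M s \<alpha> t = 0" for \<alpha> using T_not_live[OF E] by (cases "(s, \<alpha>) \<in> E") auto
  then have "(\<Sum>\<alpha>\<in>enabled M s. pmf (T s) \<alpha> * trans M s \<alpha> t) = 0" by (intro sum.neutral ballI)
  then show ?thesis by (simp add: trans_under_def)
qed (simp add: trans_under_def)

section \<open>Comparison of the expected frequencies\<close>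

lemma occupation_T_Suc:
  assumes "t \<in> active"
  shows "occupation M T (Suc n) t = (\<Sum>s\<in>active. occupation M T n s * trans_under M T s t)"
  unfolding occupation.simps
  using mdp assms by (intro sum.mono_neutral_right) (auto simp: is_mdp_def active_def[THEN eqset_imp_iff] inactive_closed)

lemma occupation_T_sums:
  assumes "t \<in> active"
  shows "(\<lambda>n. occupation M T n t) sums x t"
proof -
  have "summable (\<lambda>n. occupation M T n t)"
    by (rule transient_summable[OF transient_T occupation_0_nonneg occupation_T_Suc assms])
  moreover have "(\<Sum>n. occupation M T n t) = x t"
    by (rule transient_unique[OF transient_T _ flow_balance assms])
       (rule transient_suminf[OF transient_T occupation_0_nonneg occupation_T_Suc])
  ultimately show ?thesis by (simp add: sums_iff)
qed

lemma occupation_T_nonneg: "t \<in> active \<Longrightarrow> 0 \<le> occupation M T n t"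
  by (rule transient_iterate_nonneg[OF transient_T occupation_0_nonneg occupation_T_Suc])

lemma expected_frequency_eq_flow:
  assumes ext: "(s, \<alpha>) \<in> external M"
  shows "expected_frequency M T \<alpha> = ennreal (flow s \<alpha>)"
    and "expected_frequency N \<sigma> (Act \<alpha>) = ennreal (flow s \<alpha>)"
proof -
  have s: "s \<in> states M" "\<alpha> \<in> enabled M s" using ext by (auto simp: external_def)
  have "{u \<in> states M. \<alpha> \<in> enabled M u} = {s}" using s disjoint by blast
  then have M: "expected_frequency M T \<alpha> = (\<Sum>n. ennreal (occupation M T n s * pmf (T s) \<alpha>))"
    by (simp add: expected_frequency_eq[OF mdp lifted])
  show "expected_frequency M T \<alpha> = ennreal (flow s \<alpha>)"
  proof (cases "s \<in> active")
    case True
    have "(\<lambda>n. occupation M T n s * pmf (T s) \<alpha>) sums (x s * pmf (T s) \<alpha>)"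
      by (rule sums_mult2[OF occupation_T_sums[OF True]])
    then show ?thesis unfolding M active_external[OF True ext]
      by (intro suminf_ennreal_eq) (simp_all add: occupation_T_nonneg True)
  next
    case False
    then show ?thesis using M inactive_external[OF ext] by simp
  qed
  have "{q \<in> states N. Act \<alpha> \<in> enabled N q} = {\<iota> s}"
  proof
    show "{q \<in> states N. Act \<alpha> \<in> enabled N q} \<subseteq> {\<iota> s}"
    proof
      fix q assume "q \<in> {q \<in> states N. Act \<alpha> \<in> enabled N q}"
      then have "q \<in> states N" "Act \<alpha> \<in> enabled N q" by auto
      then show "q \<in> {\<iota> s}"
      proof (cases rule: enabled_N_cases)
        case (1 u \<beta>)
        then show ?thesis using external_inj[OF _ ext, of u] by simp
      qed simp
    qed
    show "{\<iota> s} \<subseteq> {q \<in> states N. Act \<alpha> \<in> enabled N q}"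
      using quot_map_in_states[OF s(1)] Act_enabled_external[OF ext] by simp
  qed
  then have N: "expected_frequency N \<sigma> (Act \<alpha>) =
      (\<Sum>n. ennreal (occupation N \<sigma> n (\<iota> s) * pmf (\<sigma> (\<iota> s)) (Act \<alpha>)))"
    by (simp add: expected_frequency_eq[OF mdp_N sched])
  note nt = nonterm_external[OF ext]
  have "(\<lambda>n. occupation N \<sigma> n (\<iota> s) * pmf (\<sigma> (\<iota> s)) (Act \<alpha>)) sums flow s \<alpha>"
    unfolding flow_def freq_def by (intro sums_mult2 summable_sums summable_occupation_N nt)
  then show "expected_frequency N \<sigma> (Act \<alpha>) = ennreal (flow s \<alpha>)"
    unfolding N by (intro suminf_ennreal_eq) (simp_all add: occupation_N_nonneg nt)
qed

text \<open>Covers the actions of \<open>M\<close> that are enabled in no state; they lie in no end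
  component and are not external either.\<close>

lemma expected_frequency_never_enabled:
  assumes no: "\<And>s. s \<in> states M \<Longrightarrow> \<alpha> \<notin> enabled M s"
  shows "expected_frequency M T \<alpha> = 0" "expected_frequency N \<sigma> (Act \<alpha>) = 0"
proof -
  have "{s \<in> states M. \<alpha> \<in> enabled M s} = {}" using no by blast
  then show "expected_frequency M T \<alpha> = 0" by (simp only: expected_frequency_eq[OF mdp lifted]) simp
  have "Act \<alpha> \<notin> enabled N q" if "q \<in> states N" for q
  proof
    assume "Act \<alpha> \<in> enabled N q"
    with that show False
      by (cases rule: enabled_N_cases) (use no in \<open>auto simp: external_def\<close>)
  qed
  then have "{q \<in> states N. Act \<alpha> \<in> enabled N q} = {}" by blast
  then show "expected_frequency N \<sigma> (Act \<alpha>) = 0"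
    by (simp only: expected_frequency_eq[OF mdp_N sched]) simp
qed

lemma expected_frequency_lifted:
  assumes \<alpha>: "\<And>E. mec M E \<Longrightarrow> \<alpha> \<notin> snd ` E"
  shows "expected_frequency N \<sigma> (Act \<alpha>) = expected_frequency M T \<alpha>"
proof (cases "\<exists>s\<in>states M. \<alpha> \<in> enabled M s")
  case True
  then obtain s where s: "s \<in> states M" "\<alpha> \<in> enabled M s" ..
  have "(s, \<alpha>) \<notin> E" if "mec M E" for E
  proof
    assume "(s, \<alpha>) \<in> E"
    then have "\<alpha> \<in> snd ` E" by (simp add: rev_image_eqI)
    then show False using \<alpha>[OF that] by simp
  qed
  then have "(s, \<alpha>) \<in> external M" using s by (simp add: external_def)
  from expected_frequency_eq_flow[OF this] show ?thesis by simp
next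
  case False
  then show ?thesis using expected_frequency_never_enabled[of \<alpha>] by simp
qed

end

theorem theorem4:
  fixes M :: "('s, 'a) mdp" and \<SS> :: "('s, 'a) qstate \<Rightarrow> 'a qact pmf"
  assumes "is_mdp M"
    and "\<And>s t. s \<in> states M \<Longrightarrow> t \<in> states M \<Longrightarrow> s \<noteq> t \<Longrightarrow> enabled M s \<inter> enabled M t = {}"
    and "mr_scheduler (mec_quotient M) \<SS>"
    and "\<And>E. mec M E \<Longrightarrow> pmf (\<SS> (Mec E)) Tau \<in> {0, 1}"
  shows "\<exists>\<TT>. mr_scheduler M \<TT> \<and>
           (\<forall>\<alpha>\<in>acts M. (\<forall>E. mec M E \<longrightarrow> \<alpha> \<notin> snd ` E) \<longrightarrow>
              expected_frequency (mec_quotient M) \<SS> (Act \<alpha>) = expected_frequency M \<TT> \<alpha>)"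
proof -
  interpret quotient_scheduler M \<SS> by unfold_locales (fact assms)+
  obtain T x c where "lifted_scheduler M \<SS> T x c"
    by (rule lifted_scheduler_exists[OF assms(4)])
  then interpret lifted_scheduler M \<SS> T x c .
  show ?thesis using lifted expected_frequency_lifted by blast
qed

end
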